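(* Let $d\ge2$, let $N$ be a positive integer and let $\mathcal{H}=(h_j)_{j\ge0}$ be a sequence of positive integers. There is a coupling between the internal DLA process and the $\mathcal{H}$-flashing process, using the same trajectories, in the following sense. There is a probability space carrying $N$ independent simple random walks $S_1,\dots,S_N$ on $\mathbb{Z}^d$ started at $0$, random times $T(1),\dots,T(N)$ and $T^*(1),\dots,T^*(N)$, a random set $A(N)$ having the law of the internal DLA cluster of volume $N$, and the cluster $A^*(N)$ of the $\mathcal{H}$-flashing process with explorers' trajectories $S_1,\dots,S_N$ and settling times $T^*(1),\dots,T^*(N)$, such that $$A(N)=\bigcup_{i=1}^N\{S_i(T(i))\}\quad\text{and}\quad A^*(N)=\bigcup_{i=1}^N\{S_i(T^*(i))\},$$ and $T^*(i)\ge T(i)$ for all $i=1,\dots,N$.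
   Context: Notation. $\|\cdot\|$ is the Euclidean norm; $B(x,r)=\{y\in\mathbb{R}^d:\|y-x\|<r\}$, $\mathbb{B}(x,r)=B(x,r)\cap\mathbb{Z}^d$; for $r\le R$, $\mathbb{A}(r,R)=(B(0,R)\setminus B(0,r))\cap\mathbb{Z}^d$. For $\Lambda\subset\mathbb{Z}^d$, $\partial\Lambda=\{z\in\mathbb{Z}^d\setminus\Lambda:\exists z'\in\Lambda,\ \|z-z'\|=1\}$. For a trajectory $S:\mathbb{N}\to\mathbb{Z}^d$, $H(\Lambda;S)=\min\{t\ge0:S(t)\in\Lambda\}$ (written $H(\Lambda)$ when $S$ is understood). Internal DLA. For independent simple random walks $W_1,\dots,W_N$ on $\mathbb{Z}^d$ started at $0$, set $A(0)=\varnothing$ and for $k\ge1$: $\tau_k=\inf\{t\ge0:W_k(t)\notin A(k-1)\}$, $A(k)=A(k-1)\cup\{W_k(\tau_k)\}$. $A(N)$ is the internal DLA cluster of volume $N$. Shells. Given $\mathcal{H}=(h_j)_{j\ge0}$, set $r_0=0$, $r_1=h_0+h_1$ and $r_{j+1}-h_{j+1}=r_j+h_j$ for $j\ge1$. Set $\mathcal{S}_0=\mathbb{B}(0,h_0)$, $\mathcal{S}_j=\mathbb{A}(r_j-h_j,r_j+h_j)$ for $j\ge1$, and $\Sigma_0=\{0\}$, $\Sigma_j=\partial\mathbb{B}(0,r_j)$ for $j\ge1$. For $z\in\Sigma_j$ the cell centered at $z$ is $$\mathcal{C}(z)=\mathcal{S}_j\cap\{x\in\mathbb{R}^d:\exists\lambda\ge0,\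 \exists y\in B(z,h_j/2),\ x=\lambda y\}.$$ Flashing times. For each explorer, let $(X_j,Y_j,R_j)_{j\ge0}$ be independent random variables, independent of the walk and of everything attached to the other explorers, where $X_j,Y_j$ are $\{0,1\}$-valued with $P(X_j=1)=h_j^{-d}$, $P(Y_0=1)=1$, $P(Y_j=1)=1/2$ for $j\ge1$, and $R_j$ has density $h\mapsto d\,h^{d-1}/h_j^d$ on $[0,h_j]$. For a walk $S$ started at $z_j\in\Sigma_j$, writing $h=R_j$, let $\sigma=0$ if $X_j=1$; $\sigma=H\bigl(\mathbb{B}(z_j,h\wedge(r_j+h_j-\|z_j\|))^c\bigr)$ if $X_j=0,Y_j=1$; $\sigma=H\bigl(\mathbb{A}(r_j-h,r_j+h)^c\bigr)$ if $X_j=0,Y_j=0$. For a walk $S$ started at $0$, let $H_j=H(\Sigma_j)$ and $\sigma_j=H_j+\sigma(S\circ\theta_{H_j})$, where $\theta$ is the time shift. $\sigma_j$ is a flashing time if $S(\sigma_j)\in\mathcal{C}(S(H_j))$. $\mathcal{H}$-flashing process. Given $N$ independent simple random walks $S_1,\dots,S_N$ started at $0$ with associated times $H_{i,j},\sigma_{i,j}$ and $z_{i,j}=S_i(H_{i,j})$, set $A^*(0)=\varnothing$ and for $i\ge1$ $$\tau_i^*=\min\{\sigma_{i,j}: j\ge0,\ S_i(\sigma_{i,j})\in\mathcal{C}(z_{i,j})\cap A^*(i-1)^c\},\qquad A^*(i)=A^*(i-1)\cup\{S_i(\tau_i^* )\}.$$ $\tau_i^*$ is the settling time of explorer $i$.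 *)

theory Defs
  imports "HOL-Probability.Probability"
begin

text \<open>Lattice geometry. The lattice $\mathbb{Z}^d$ is the type \<open>int ^ 'd\<close>, with \<open>d = CARD('d)\<close>; Euclidean
  notions are taken in \<open>real ^ 'd\<close> after coordinatewise embedding.\<close>

definition rvec :: "int ^ 'd \<Rightarrow> real ^ 'd" where
  "rvec x = (\<chi> k. real_of_int (x $ k))"

definition lattice_ball :: "int ^ 'd::finite \<Rightarrow> real \<Rightarrow> (int ^ 'd) set" where
  "lattice_ball x r = {y. rvec y \<in> ball (rvec x) r}"

definition lattice_annulus :: "real \<Rightarrow> real \<Rightarrow> (int ^ 'd::finite) set" where
  "lattice_annulus r R = {y. rvec y \<in> ball 0 R - ball 0 r}"

definition outer_boundary :: "(int ^ 'd::finite) set \<Rightarrow> (int ^ 'd) set" where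
  "outer_boundary L = {z. z \<notin> L \<and> (\<exists>z'\<in>L. norm (rvec z - rvec z') = 1)}"

text \<open>Times are extended naturals: a time that never occurs is \<open>\<infinity>\<close>, the infimum of the empty set.\<close>

definition hitting_time :: "'s set \<Rightarrow> (nat \<Rightarrow> 's) \<Rightarrow> enat" where
  "hitting_time L S = Inf {enat t | t. S t \<in> L}"

text \<open>\<open>site_at S \<tau>\<close> is the singleton of the position at time \<open>\<tau>\<close>, or empty if \<open>\<tau> = \<infinity>\<close>. Thus an
  explorer that never settles (an event of probability zero) adds nothing to the cluster.\<close>

definition site_at :: "(nat \<Rightarrow> 's) \<Rightarrow> enat \<Rightarrow> 's set" where
  "site_at S \<tau> = {S t | t. \<tau> = enat t}"


text \<open>Simple random walk from the origin: partial sums of independent uniform unit steps.\<close>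

definition unit_steps :: "(int ^ 'd::finite) set" where
  "unit_steps = range (\<lambda>k. axis k 1) \<union> range (\<lambda>k. axis k (- 1))"

definition trajectory_space :: "(nat \<Rightarrow> int ^ 'd::finite) measure" where
  "trajectory_space = (\<Pi>\<^sub>M t\<in>UNIV. count_space UNIV)"

definition srw_law :: "(nat \<Rightarrow> int ^ 'd::finite) measure" where
  "srw_law = distr (\<Pi>\<^sub>M t\<in>UNIV. measure_pmf (pmf_of_set unit_steps)) trajectory_space
                   (\<lambda>\<xi> t. \<Sum>k<t. \<xi> k)"


text \<open>Internal DLA; the family \<open>W\<close> of trajectories is indexed from 1.\<close>

primrec idla_cluster :: "(nat \<Rightarrow> nat \<Rightarrow> int ^ 'd::finite) \<Rightarrow> nat \<Rightarrow> (int ^ 'd) set" where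
  "idla_cluster W 0 = {}"
| "idla_cluster W (Suc k) =
     idla_cluster W k \<union> site_at (W (Suc k)) (hitting_time (- idla_cluster W k) (W (Suc k)))"

definition idla_law :: "nat \<Rightarrow> (int ^ 'd::finite) set measure" where
  "idla_law N = distr (\<Pi>\<^sub>M i\<in>{1..N}. srw_law) (count_space UNIV) (\<lambda>W. idla_cluster W N)"


text \<open>Shells and cells. The recursion for the radii covers both \<open>r\<^sub>1 = h\<^sub>0 + h\<^sub>1\<close> (as \<open>r\<^sub>0 = 0\<close>) and
  \<open>r\<^sub>j\<^sub>+\<^sub>1 - h\<^sub>j\<^sub>+\<^sub>1 = r\<^sub>j + h\<^sub>j\<close>.\<close>

primrec radius :: "(nat \<Rightarrow> nat) \<Rightarrow> nat \<Rightarrow> nat" where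
  "radius h 0 = 0"
| "radius h (Suc j) = radius h j + h j + h (Suc j)"

definition shell :: "(nat \<Rightarrow> nat) \<Rightarrow> nat \<Rightarrow> (int ^ 'd::finite) set" where
  "shell h j = (if j = 0 then lattice_ball 0 (real (h 0))
                else lattice_annulus (real (radius h j) - real (h j)) (real (radius h j) + real (h j)))"

definition sphere_sites :: "(nat \<Rightarrow> nat) \<Rightarrow> nat \<Rightarrow> (int ^ 'd::finite) set" where
  "sphere_sites h j = (if j = 0 then {0} else outer_boundary (lattice_ball 0 (real (radius h j))))"

definition cell :: "(nat \<Rightarrow> nat) \<Rightarrow> nat \<Rightarrow> int ^ 'd::finite \<Rightarrow> (int ^ 'd) set" where
  "cell h j z = shell h j \<inter> {x. \<exists>c\<ge>0. \<exists>y\<in>ball (rvec z) (real (h j) / 2). rvec x = c *\<^sub>R y}"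


text \<open>The flashing process. The \<open>{0,1}\<close>-valued variables are Booleans, with \<open>True\<close> for 1.
  \<open>flash_delay\<close> is the time \<open>\<sigma>\<close> of a trajectory started at \<open>S 0\<close> in \<open>sphere_sites h j\<close>.\<close>

definition flash_delay ::
  "(nat \<Rightarrow> nat) \<Rightarrow> nat \<Rightarrow> bool \<Rightarrow> bool \<Rightarrow> real \<Rightarrow> (nat \<Rightarrow> int ^ 'd::finite) \<Rightarrow> enat" where
  "flash_delay h j x y \<rho> S =
     (if x then 0
      else if y then
        hitting_time
          (- lattice_ball (S 0) (min \<rho> (real (radius h j) + real (h j) - norm (rvec (S 0))))) S
      else hitting_time (- lattice_annulus (real (radius h j) - \<rho>) (real (radius h j) + \<rho>)) S)"

definition arrival_time :: "(nat \<Rightarrow> nat) \<Rightarrow> nat \<Rightarrow> (nat \<Rightarrow> int ^ 'd::finite) \<Rightarrow> enat" where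
  "arrival_time h j S = hitting_time (sphere_sites h j) S"

definition candidate_time ::
  "(nat \<Rightarrow> nat) \<Rightarrow> (nat \<Rightarrow> int ^ 'd::finite) \<Rightarrow> (nat \<Rightarrow> bool) \<Rightarrow> (nat \<Rightarrow> bool) \<Rightarrow> (nat \<Rightarrow> real)
    \<Rightarrow> nat \<Rightarrow> enat" where
  "candidate_time h S x y \<rho> j =
     (case arrival_time h j S of
        enat a \<Rightarrow> enat a + flash_delay h j (x j) (y j) (\<rho> j) (\<lambda>t. S (a + t))
      | \<infinity> \<Rightarrow> \<infinity>)"

text \<open>\<open>settling_time h S x y \<rho> A\<close> is the settling time of an explorer facing the cluster \<open>A\<close>.\<close>

definition settling_time ::
  "(nat \<Rightarrow> nat) \<Rightarrow> (nat \<Rightarrow> int ^ 'd::finite) \<Rightarrow> (nat \<Rightarrow> bool) \<Rightarrow> (nat \<Rightarrow> bool) \<Rightarrow> (nat \<Rightarrow> real)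
    \<Rightarrow> (int ^ 'd) set \<Rightarrow> enat" where
  "settling_time h S x y \<rho> A =
     Inf {enat t | t. \<exists>j a. arrival_time h j S = enat a \<and> candidate_time h S x y \<rho> j = enat t
                           \<and> S t \<in> cell h j (S a) - A}"

primrec flashing_cluster ::
  "(nat \<Rightarrow> nat) \<Rightarrow> (nat \<Rightarrow> nat \<Rightarrow> int ^ 'd::finite) \<Rightarrow> (nat \<Rightarrow> nat \<Rightarrow> bool) \<Rightarrow> (nat \<Rightarrow> nat \<Rightarrow> bool)
    \<Rightarrow> (nat \<Rightarrow> nat \<Rightarrow> real) \<Rightarrow> nat \<Rightarrow> (int ^ 'd) set" where
  "flashing_cluster h S x y \<rho> 0 = {}"
| "flashing_cluster h S x y \<rho> (Suc i) =
     flashing_cluster h S x y \<rho> i \<union>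
     site_at (S (Suc i))
       (settling_time h (S (Suc i)) (x (Suc i)) (y (Suc i)) (\<rho> (Suc i)) (flashing_cluster h S x y \<rho> i))"


text \<open>The probabilistic input. The random elements have different types, so their joint independence
  is expressed as independence of the \<open>\<sigma>\<close>-algebras they generate, indexed by the following type:
  the walk of explorer \<open>i\<close>, and its variables \<open>X\<^sub>j\<close>, \<open>Y\<^sub>j\<close>, \<open>R\<^sub>j\<close>.\<close>

datatype source = Walk (explorer: nat) | Coin_X (explorer: nat) nat | Coin_Y (explorer: nat) nat
  | Radius_R (explorer: nat) nat

definition generated :: "'w measure \<Rightarrow> ('w \<Rightarrow> 'b) \<Rightarrow> 'b measure \<Rightarrow> 'w set set" where
  "generated M f B = sets (vimage_algebra (space M) f B)"

definition source_algebra ::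
  "'w measure \<Rightarrow> (nat \<Rightarrow> 'w \<Rightarrow> nat \<Rightarrow> int ^ 'd::finite) \<Rightarrow> (nat \<Rightarrow> 'w \<Rightarrow> nat \<Rightarrow> bool)
    \<Rightarrow> (nat \<Rightarrow> 'w \<Rightarrow> nat \<Rightarrow> bool) \<Rightarrow> (nat \<Rightarrow> 'w \<Rightarrow> nat \<Rightarrow> real) \<Rightarrow> source \<Rightarrow> 'w set set" where
  "source_algebra M S X Y R s =
     (case s of
        Walk i \<Rightarrow> generated M (S i) trajectory_space
      | Coin_X i j \<Rightarrow> generated M (\<lambda>w. X i w j) (count_space UNIV)
      | Coin_Y i j \<Rightarrow> generated M (\<lambda>w. Y i w j) (count_space UNIV)
      | Radius_R i j \<Rightarrow> generated M (\<lambda>w. R i w j) borel)"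

definition flashing_explorers ::
  "'w measure \<Rightarrow> (nat \<Rightarrow> nat) \<Rightarrow> nat \<Rightarrow> (nat \<Rightarrow> 'w \<Rightarrow> nat \<Rightarrow> int ^ 'd::finite)
    \<Rightarrow> (nat \<Rightarrow> 'w \<Rightarrow> nat \<Rightarrow> bool) \<Rightarrow> (nat \<Rightarrow> 'w \<Rightarrow> nat \<Rightarrow> bool) \<Rightarrow> (nat \<Rightarrow> 'w \<Rightarrow> nat \<Rightarrow> real) \<Rightarrow> bool" where
  "flashing_explorers M h N S X Y R \<longleftrightarrow>
     prob_space M \<and>
     prob_space.indep_sets M (source_algebra M S X Y R) {s. explorer s \<in> {1..N}} \<and>
     (\<forall>i\<in>{1..N}.
        S i \<in> measurable M trajectory_space \<and> distr M trajectory_space (S i) = srw_law \<and>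
        (\<forall>j. (\<lambda>w. X i w j) \<in> measurable M (count_space UNIV) \<and>
             measure M {w \<in> space M. X i w j} = 1 / real (h j) ^ CARD('d) \<and>
             (\<lambda>w. Y i w j) \<in> measurable M (count_space UNIV) \<and>
             measure M {w \<in> space M. Y i w j} = (if j = 0 then 1 else 1 / 2) \<and>
             distributed M lborel (\<lambda>w. R i w j)
               (\<lambda>r. ennreal (real CARD('d) * r ^ (CARD('d) - 1) / real (h j) ^ CARD('d)
                              * indicator {0..real (h j)} r))))"

end

theory Submission
  imports Defs
begin

text \<open>Internal DLA is driven by a single stream of steps: the explorer in flight takes steps until it
  leaves the occupied set, then a new one is launched at the origin. Hence the law of the cluster does
  not depend on how the stream is cut into trajectories, as long as the walk that makes the next
  step is chosen from the steps revealed so far and from randomness independent of the walks: for a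
  fixed stream the revealed steps form fixed initial pieces of the \<open>N\<close> trajectories, and the probability
  that the walks follow these pieces is the product of the step probabilities.

  Exactly one occupied site carries two explorers while the process runs. The coupling moves one
  of them, chosen so that no explorer moves past its settling time in the flashing process. Whether an
  explorer flashes now is known from its past and its coins; if both do, the one of smaller index
  settles now unless the site already belongs to the earlier flashing cluster, so the site belongs to
  the flashing cluster seen by the other one, which can be moved. Settling times are almost surely finite because
  infinitely many shells have coins that force a flash in the cell, so the process terminates and
  the stopped trajectories cover the internal DLA cluster.\<close>

section \<open>Internal DLA driven by a stream of steps\<close>

text \<open>The rule cannot ask whether an explorer has settled in the flashing process: this
  depends on the clusters left by the explorers of smaller index, hence on steps not yet revealed.
  It asks only whether the present time is a flashing time, which the path so far and the coins
  decide. The comparison of indices makes up for the missing information, because a flash of an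
  explorer puts its site into the flashing cluster no later than when that explorer has had its
  turn.

  Completion of ordinary internal DLA is not proved by studying exits of one walk from a finite set.
  The probability of completion is a sum of step weights over streams, the same for every rule. It
  equals 1 for the coupling, where each clock stays below a finite settling time, and therefore
  equals 1 for walks released one at a time.

  The origin is occupied from the start because the first explorer settles there at time 0. So the
  number of occupied sites is the number of settled explorers, and there is always one more explorer
  than sites.\<close>

text \<open>Throughout, lists of steps have the latest step at the head. The second component is the position of
  the explorer in flight; it is \<open>0\<close> right after a settlement, where the next explorer starts.\<close>

primrec stream_idla :: "'a::ab_group_add list \<Rightarrow> 'a set \<times> 'a" where
  "stream_idla [] = ({0}, 0)"
| "stream_idla (v # vs) =
     (let (C, x) = stream_idla vs in if x + v \<in> C then (C, x + v) else (insert (x + v) C, 0))"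

definition occupied :: "'a::ab_group_add list \<Rightarrow> 'a set" where
  "occupied vs = fst (stream_idla vs)"

definition token :: "'a::ab_group_add list \<Rightarrow> 'a" where
  "token vs = snd (stream_idla vs)"

text \<open>The second clause makes completing streams minimal: none is a proper suffix, that is, an
  earlier state, of another. This is what turns different completing streams into disjoint
  events.\<close>

definition completes :: "nat \<Rightarrow> 'a::ab_group_add list \<Rightarrow> bool" where
  "completes N vs \<longleftrightarrow> card (occupied vs) = N \<and> (vs = [] \<or> card (occupied (tl vs)) < N)"

text \<open>The rule sees the labelled past only, so for a given rule the labels are a function of
  the stream and refer to no walk. \<open>history\<close> goes the other way and reads the stream
  off the walks.\<close>

primrec schedule :: "((nat \<times> 'a) list \<Rightarrow> nat) \<Rightarrow> 'a list \<Rightarrow> (nat \<times> 'a) list" where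
  "schedule c [] = []"
| "schedule c (v # vs) = (c (schedule c vs), v) # schedule c vs"

definition steps_of :: "nat \<Rightarrow> (nat \<times> 'a) list \<Rightarrow> 'a list" where
  "steps_of i us = map snd (filter (\<lambda>u. fst u = i) us)"

primrec follows :: "(nat \<Rightarrow> 'a::ab_group_add) \<Rightarrow> 'a list \<Rightarrow> bool" where
  "follows S [] \<longleftrightarrow> S 0 = 0"
| "follows S (v # p) \<longleftrightarrow> follows S p \<and> S (Suc (length p)) = v + sum_list p"

text \<open>The canonical trajectory along a finite path, resting at its end afterwards. On it, a
  property that looks no further than time \<open>length p\<close> can be evaluated without the
  walk.\<close>

definition path_walk :: "'a::ab_group_add list \<Rightarrow> nat \<Rightarrow> 'a" where
  "path_walk p k = sum_list (drop (length p - k) p)"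

primrec history :: "(nat \<Rightarrow> nat \<Rightarrow> 'a::ab_group_add) \<Rightarrow> ((nat \<times> 'a) list \<Rightarrow> nat) \<Rightarrow> nat \<Rightarrow> 'a list" where
  "history W c 0 = []"
| "history W c (Suc n) =
     (let us = schedule c (history W c n); a = c us; t = length (steps_of a us)
      in (W a (Suc t) - W a t) # history W c n)"

definition completion_step :: "nat \<Rightarrow> (nat \<Rightarrow> nat \<Rightarrow> 'a::ab_group_add) \<Rightarrow> ((nat \<times> 'a) list \<Rightarrow> nat) \<Rightarrow> nat" where
  "completion_step N W c = (LEAST n. card (occupied (history W c n)) = N)"

section \<open>Streams, schedules and the walks that produce them\<close>

lemma occupied_Nil [simp]: "occupied [] = {0}"
  and token_Nil [simp]: "token [] = 0"
  and occupied_Cons: "occupied (v # vs) = insert (token vs + v) (occupied vs)"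
  and token_Cons: "token (v # vs) = (if token vs + v \<in> occupied vs then token vs + v else 0)"
  by (auto simp: occupied_def token_def Let_def split: prod.splits)

lemma finite_occupied [simp]: "finite (occupied vs)"
  by (induction vs) (auto simp: occupied_Cons)

lemma zero_in_occupied [simp]: "0 \<in> occupied vs"
  by (induction vs) (auto simp: occupied_Cons)

lemma card_occupied_Cons:
  "card (occupied (v # vs)) =
     (if token vs + v \<in> occupied vs then card (occupied vs) else Suc (card (occupied vs)))"
  by (auto simp: occupied_Cons insert_absorb)

lemma map_snd_schedule [simp]: "map snd (schedule c vs) = vs"
  by (induction vs) auto

lemma fst_schedule_in:
  assumes "\<And>us. c us \<in> I" "u \<in> set (schedule c vs)"
  shows "fst u \<in> I"
  using assms(2) by (induction vs) (auto simp: assms(1))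

lemma steps_of_Nil [simp]: "steps_of i [] = []"
  and steps_of_Cons [simp]: "steps_of i (u # us) = (if fst u = i then snd u # steps_of i us else steps_of i us)"
  by (auto simp: steps_of_def)

lemma follows_end: "follows S p \<Longrightarrow> S (length p) = sum_list p"
  by (cases p) auto

lemma follows_unique:
  assumes "follows S p" "follows S' p" "t \<le> length p"
  shows "S t = S' t"
  using assms by (induction p) (auto simp: le_Suc_eq)

lemma follows_cong:
  assumes "\<And>k. k \<le> length p \<Longrightarrow> S k = S' k"
  shows "follows S p \<longleftrightarrow> follows S' p"
  using assms by (induction p) auto

lemma follows_path_walk: "follows (path_walk p) p"
proof (induction p)
  case (Cons v p)
  have "path_walk (v # p) k = path_walk p k" if "k \<le> length p" for k
    using that by (simp add: path_walk_def Suc_diff_le)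
  then have "follows (path_walk (v # p)) p"
    using Cons follows_cong by blast
  moreover have "path_walk (v # p) (Suc (length p)) = v + sum_list p"
    by (simp add: path_walk_def)
  ultimately show ?case by simp
qed (simp add: path_walk_def)

lemma follows_history:
  assumes "\<And>us. c us \<in> I" "\<And>i. i \<in> I \<Longrightarrow> W i 0 = 0" "i \<in> I"
  shows "follows (W i) (steps_of i (schedule c (history W c n)))"
proof (induction n)
  case (Suc n)
  then show ?case
    by (auto simp: Let_def follows_end)
qed (use assms in auto)

lemma length_history [simp]: "length (history W c n) = n"
  by (induction n) (auto simp: Let_def)

text \<open>Converse to \<open>follows_history\<close>. Together they identify the event that the
  process reveals \<open>vs\<close> with the event that every walk follows its share of
  \<open>vs\<close>; the latter concerns given finite paths, so its probability is
  computable.\<close>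

lemma history_eqI:
  assumes "\<And>us. c us \<in> I" "\<And>i. i \<in> I \<Longrightarrow> follows (W i) (steps_of i (schedule c vs))"
  shows "history W c (length vs) = vs"
  using assms(2)
proof (induction vs)
  case (Cons v vs)
  have f: "follows (W i) (steps_of i (schedule c vs))" if "i \<in> I" for i
    using Cons.prems[OF that] by (auto split: if_splits)
  have "follows (W (c (schedule c vs))) (v # steps_of (c (schedule c vs)) (schedule c vs))"
    using Cons.prems[OF assms(1)[of "schedule c vs"]] by simp
  then show ?case using Cons.IH[OF f] by (simp add: Let_def follows_end)
qed simp

lemma tl_history: "tl (history W c (Suc n)) = history W c n"
  by (simp add: Let_def)

lemma card_occupied_history_mono:
  assumes "m \<le> n" shows "card (occupied (history W c m)) \<le> card (occupied (history W c n))"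
  by (rule lift_Suc_mono_le[OF _ assms]) (simp add: Let_def card_occupied_Cons)

lemma completion_step_eq:
  assumes "history W c (length vs) = vs" "completes N vs"
  shows "completion_step N W c = length vs"
  unfolding completion_step_def
proof (rule Least_equality)
  fix n assume n: "card (occupied (history W c n)) = N"
  show "length vs \<le> n"
  proof (rule ccontr)
    assume "\<not> length vs \<le> n"
    then obtain l where l: "length vs = Suc l" "n \<le> l" by (cases "length vs") auto
    have "history W c l = tl vs" using assms(1) l tl_history[of W c l] by simp
    then have "N \<le> card (occupied (tl vs))"
      using card_occupied_history_mono[OF l(2), of W c] n by simp
    then show False using assms(2) l by (auto simp: completes_def)
  qed
qed (use assms in \<open>auto simp: completes_def\<close>)

text \<open>A step adds at most one site, so the number of occupied sites cannot jump over
  \<open>N\<close>; it starts at 1, whence \<open>0 < N\<close>.\<close>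

lemma completes_history:
  assumes "N \<le> card (occupied (history W c n))" "0 < N"
  shows "completes N (history W c (completion_step N W c))"
    and "completion_step N W c \<le> n"
proof -
  have "\<exists>m\<le>n. card (occupied (history W c m)) = N"
    using assms(1)
  proof (induction n)
    case 0
    then show ?case using assms(2) by simp
  next
    case (Suc n)
    show ?case
    proof (cases "N \<le> card (occupied (history W c n))")
      case True
      then show ?thesis using Suc.IH le_SucI by blast
    next
      case False
      then show ?thesis using Suc.prems
        by (intro exI[of _ "Suc n"]) (auto simp: Let_def card_occupied_Cons split: if_splits)
    qed
  qed
  then obtain m where m: "m \<le> n" "card (occupied (history W c m)) = N" by blast
  let ?s = "completion_step N W c"
  have s: "card (occupied (history W c ?s)) = N"
    unfolding completion_step_def by (rule LeastI[of _ m]) (rule m)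
  have "?s \<le> m"
    unfolding completion_step_def by (rule Least_le) (rule m)
  then show "?s \<le> n" using m by simp
  show "completes N (history W c ?s)"
  proof (cases ?s)
    case 0
    then show ?thesis using s by (simp add: completes_def)
  next
    case (Suc l)
    have "card (occupied (history W c l)) \<noteq> N"
      using Suc not_less_Least[of l "\<lambda>n. card (occupied (history W c n)) = N"]
      unfolding completion_step_def by auto
    moreover have "card (occupied (history W c l)) \<le> N"
      using card_occupied_history_mono[of l "?s" W c] Suc s by simp
    ultimately have "card (occupied (tl (history W c (Suc l)))) < N" unfolding tl_history by simp
    then show ?thesis using s Suc unfolding completes_def by simp
  qed
qed

text \<open>Both streams are histories of the same walks under the same rule, and both have length
  \<open>completion_step N W c\<close>.\<close>

lemma completes_unique:
  assumes "\<And>us. c us \<in> I"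
    and "\<And>i. i \<in> I \<Longrightarrow> follows (W i) (steps_of i (schedule c vs))" "completes N vs"
    and "\<And>i. i \<in> I \<Longrightarrow> follows (W i) (steps_of i (schedule c vs'))" "completes N vs'"
  shows "vs = vs'"
proof -
  have vs: "history W c (length vs) = vs"
  proof (rule history_eqI[where c = c and W = W and I = I])
    show "c us \<in> I" for us by (rule assms(1))
    show "follows (W i) (steps_of i (schedule c vs))" if "i \<in> I" for i by (rule assms(2)[OF that])
  qed
  have vs': "history W c (length vs') = vs'"
  proof (rule history_eqI[where c = c and W = W and I = I])
    show "c us \<in> I" for us by (rule assms(1))
    show "follows (W i) (steps_of i (schedule c vs'))" if "i \<in> I" for i by (rule assms(4)[OF that])
  qed
  have "length vs = length vs'"
    by (rule trans[OF completion_step_eq[OF vs assms(3), symmetric] completion_step_eq[OF vs' assms(5)]])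
  then have "history W c (length vs) = history W c (length vs')" by (rule arg_cong)
  then show ?thesis unfolding vs vs' .
qed

section \<open>Hitting times and the release of walks one at a time\<close>

lemma hitting_time_eq_enat:
  "hitting_time L S = enat a \<longleftrightarrow> S a \<in> L \<and> (\<forall>b<a. S b \<notin> L)"
proof
  assume H: "hitting_time L S = enat a"
  have "{enat t |t. S t \<in> L} \<noteq> {}"
  proof
    assume "{enat t |t. S t \<in> L} = {}"
    then have "hitting_time L S = \<infinity>"
      by (simp only: hitting_time_def Inf_empty top_enat_def)
    then show False using H by simp
  qed
  then obtain t where "t \<in> {enat t |t. S t \<in> L}" by blast
  then have "hitting_time L S \<in> {enat t |t. S t \<in> L}"
    unfolding hitting_time_def by (rule wellorder_InfI)
  moreover have "enat b \<ge> enat a" if "S b \<in> L" for b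
    using that H by (metis (mono_tags, lifting) hitting_time_def mem_Collect_eq wellorder_Inf_le1)
  ultimately show "S a \<in> L \<and> (\<forall>b<a. S b \<notin> L)" using H by force
next
  assume *: "S a \<in> L \<and> (\<forall>b<a. S b \<notin> L)"
  show "hitting_time L S = enat a"
    unfolding hitting_time_def
  proof (rule antisym)
    show "Inf {enat t |t. S t \<in> L} \<le> enat a" by (rule Inf_lower) (use * in auto)
    show "enat a \<le> Inf {enat t |t. S t \<in> L}"
      by (rule Inf_greatest) (use * in \<open>force simp: not_less[symmetric]\<close>)
  qed
qed

lemma hitting_time_finite:
  assumes "S t \<in> L" shows "\<exists>a\<le>t. hitting_time L S = enat a"
proof -
  let ?a = "LEAST a. S a \<in> L"
  have "hitting_time L S = enat ?a"
    unfolding hitting_time_eq_enat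
    using LeastI[of "\<lambda>a. S a \<in> L", OF assms] not_less_Least[of _ "\<lambda>a. S a \<in> L"] by blast
  then show ?thesis using Least_le[of "\<lambda>a. S a \<in> L", OF assms] by blast
qed

text \<open>The rule of ordinary internal DLA: with m occupied sites, m walks have settled and walk
  m + 1 is in flight. The minimum only matters once \<open>N\<close> sites are occupied and keeps
  the rule in \<open>{1..N}\<close>.\<close>

definition one_by_one :: "nat \<Rightarrow> (nat \<times> 'a::ab_group_add) list \<Rightarrow> nat" where
  "one_by_one N us = min N (Suc (card (occupied (map snd us))))"

lemma idla_cluster_one_by_one:
  fixes W :: "nat \<Rightarrow> nat \<Rightarrow> int ^ 'd::finite"
  assumes "\<And>i. i \<in> {1..N} \<Longrightarrow> follows (W i) (steps_of i (schedule (one_by_one N) vs))" "completes N vs"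
    and "0 < N"
  shows "idla_cluster W N = occupied vs"
proof -
  let ?c = "one_by_one N"
  let ?p = "\<lambda>i vs. steps_of i (schedule ?c vs)" and ?m = "\<lambda>vs :: (int ^ 'd) list. card (occupied vs)"
  \<comment> \<open>With m occupied sites: the first m explorers have produced them, later ones than
    m + 1 have not moved, and explorer m + 1 stands at the token without ever having left the
    occupied set. The last part is claimed for m < N only, since nothing is assumed about walk
    \<open>N + 1\<close>.\<close>
  have "idla_cluster W (?m vs) = occupied vs \<and> (\<forall>i>Suc (?m vs). ?p i vs = []) \<and>
     (?m vs < N \<longrightarrow> sum_list (?p (Suc (?m vs)) vs) = token vs \<and>
        (\<forall>t\<le>length (?p (Suc (?m vs)) vs). W (Suc (?m vs)) t \<in> occupied vs))"
    if "vs = [] \<or> ?m (tl vs) < N" "\<And>i. i \<in> {1..N} \<Longrightarrow> follows (W i) (?p i vs)" for vs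
    using that
  proof (induction vs)
    case Nil
    have W0: "W i 0 = 0" if "i \<in> {1..N}" for i using Nil.prems(2)[OF that] by simp
    have "hitting_time UNIV (W 1) = enat 0" by (simp add: hitting_time_eq_enat)
    then have "idla_cluster W 1 = {0}" using W0[of 1] assms(3) by (auto simp: site_at_def zero_enat_def)
    then show ?case using W0 by auto
  next
    case (Cons v vs)
    define m where "m = ?m vs"
    define x where "x = token vs"
    have mN: "m < N" using Cons.prems(1) by (simp add: m_def)
    have c: "?c (schedule ?c vs) = Suc m" using mN by (simp add: one_by_one_def m_def)
    have f: "follows (W i) (?p i vs)" if "i \<in> {1..N}" for i
      using Cons.prems(2)[OF that] by (auto split: if_splits)
    have "vs = [] \<or> ?m (tl vs) < N"
      using mN by (cases vs) (auto simp: m_def card_occupied_Cons split: if_splits)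
    from Cons.IH[OF this f] mN have IH: "idla_cluster W m = occupied vs"
      "\<And>i. i > Suc m \<Longrightarrow> ?p i vs = []" "sum_list (?p (Suc m) vs) = x"
      "\<And>t. t \<le> length (?p (Suc m) vs) \<Longrightarrow> W (Suc m) t \<in> occupied vs"
      by (auto simp: m_def x_def)
    have end_pos: "W (Suc m) (Suc (length (?p (Suc m) vs))) = x + v"
      using Cons.prems(2)[of "Suc m"] mN IH(3) by (simp add: c add.commute)
    show ?case
    proof (cases "x + v \<in> occupied vs")
      case True
      then have [simp]: "card (occupied vs) = m" "occupied (v # vs) = occupied vs" "token (v # vs) = x + v"
        by (auto simp: m_def x_def occupied_Cons insert_absorb token_Cons)
      show ?thesis
        using IH end_pos True by (auto simp: c le_Suc_eq add.commute)
    next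
      case False
      then have [simp]: "card (insert (x + v) (occupied vs)) = Suc m"
          "occupied (v # vs) = insert (x + v) (occupied vs)" "token (v # vs) = 0"
        by (auto simp: m_def x_def occupied_Cons token_Cons)
      have "hitting_time (- occupied vs) (W (Suc m)) = enat (Suc (length (?p (Suc m) vs)))"
        unfolding hitting_time_eq_enat using IH(4) False end_pos by (auto simp: less_Suc_eq_le)
      then have "idla_cluster W (Suc m) = insert (x + v) (occupied vs)"
        using IH(1) end_pos by (auto simp: site_at_def)
      moreover have "W (Suc (Suc m)) 0 = 0" if "Suc m < N"
        using f[of "Suc (Suc m)"] IH(2)[of "Suc (Suc m)"] that by simp
      ultimately show ?thesis
        using IH(2) by (auto simp: c)
    qed
  qed
  from this[of vs] assms show ?thesis by (auto simp: completes_def)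
qed

section \<open>The scheduling rule of the coupling\<close>

definition position :: "nat \<Rightarrow> (nat \<times> 'a::ab_group_add) list \<Rightarrow> 'a" where
  "position i us = sum_list (steps_of i us)"

text \<open>\<open>k\<close> is the number of explorers released so far, and \<open>f i p\<close>
  stands for a flash of explorer \<open>i\<close> at the end of the path \<open>p\<close>. An
  explorer that flashes may leave only in favour of one of smaller index that flashes too; one that
  does not flash may leave any shared site.\<close>

definition movable ::
  "(nat \<Rightarrow> 'a::ab_group_add list \<Rightarrow> bool) \<Rightarrow> (nat \<times> 'a) list \<Rightarrow> nat \<Rightarrow> nat \<Rightarrow> bool" where
  "movable f us k a \<longleftrightarrow> a \<in> {1..k} \<and>
     (\<exists>b\<in>{1..k}. b \<noteq> a \<and> position b us = position a us \<and>
        (f a (steps_of a us) \<longrightarrow> f b (steps_of b us) \<and> b < a))"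

text \<open>The default value \<open>N\<close> only serves to keep the rule in \<open>{1..N}\<close> on all lists; it is not used
  before \<open>N\<close> sites are occupied.\<close>

definition yielding ::
  "nat \<Rightarrow> (nat \<Rightarrow> 'a::ab_group_add list \<Rightarrow> bool) \<Rightarrow> (nat \<times> 'a) list \<Rightarrow> nat" where
  "yielding N f us =
     (let a = LEAST a. movable f us (Suc (card (occupied (map snd us)))) a
      in if a \<in> {1..N} then a else N)"

lemma yielding_in: "0 < N \<Longrightarrow> yielding N f us \<in> {1..N}"
  by (auto simp: yielding_def Let_def)

text \<open>The last clause keeps the explorers not yet released at the origin with empty paths, so
  that the next one is already in place when a site is added.\<close>

definition one_double :: "'a::ab_group_add list \<Rightarrow> (nat \<times> 'a) list \<Rightarrow> bool" where
  "one_double vs us \<longleftrightarrow>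
     (let k = Suc (card (occupied vs)) in
        (\<lambda>i. position i us) ` {1..k} = occupied vs \<and>
        (\<forall>i\<in>{1..k}. \<forall>j\<in>{1..k}. i \<noteq> j \<and> position i us = position j us \<longrightarrow> position i us = token vs) \<and>
        (\<forall>i>k. steps_of i us = []))"

lemma one_doubleI:
  assumes "k = Suc (card (occupied vs))" "(\<lambda>i. position i us) ` {1..k} = occupied vs"
    and "\<And>i j. i \<in> {1..k} \<Longrightarrow> j \<in> {1..k} \<Longrightarrow> i \<noteq> j \<Longrightarrow> position i us = position j us \<Longrightarrow>
           position i us = token vs"
    and "\<And>i. i > k \<Longrightarrow> steps_of i us = []"
  shows "one_double vs us"
  using assms unfolding one_double_def Let_def by blast

text \<open>Pigeonhole: there is one more explorer than there are sites.\<close>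

lemma one_double_collision:
  assumes "one_double vs us"
  shows "\<exists>i\<in>{1..Suc (card (occupied vs))}. \<exists>j\<in>{1..Suc (card (occupied vs))}.
           i \<noteq> j \<and> position i us = position j us"
proof (rule ccontr)
  let ?k = "Suc (card (occupied vs))"
  assume "\<not> ?thesis"
  then have "inj_on (\<lambda>i. position i us) {1..?k}" by (auto simp: inj_on_def)
  then have "card ((\<lambda>i. position i us) ` {1..?k}) = ?k" by (simp add: card_image)
  then show False using assms by (simp add: one_double_def Let_def)
qed

text \<open>Of two explorers on one site, the one of larger index is movable if the other flashes;
  otherwise the one of smaller index is movable.\<close>

lemma movable_exists:
  assumes "one_double vs us"
  shows "\<exists>a. movable f us (Suc (card (occupied vs))) a"
proof -
  obtain i j where ij: "i \<in> {1..Suc (card (occupied vs))}" "j \<in> {1..Suc (card (occupied vs))}"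
      "i < j" "position i us = position j us"
    using one_double_collision[OF assms] by (metis linorder_neqE_nat)
  show ?thesis
  proof (cases "f i (steps_of i us)")
    case True
    then have "movable f us (Suc (card (occupied vs))) j"
      unfolding movable_def using ij by (intro conjI bexI[of _ i]) auto
    then show ?thesis by blast
  next
    case False
    then have "movable f us (Suc (card (occupied vs))) i"
      unfolding movable_def using ij by (intro conjI bexI[of _ j]) auto
    then show ?thesis by blast
  qed
qed

lemma movable_yielding:
  assumes "one_double vs us" "map snd us = vs" "card (occupied vs) < N"
  shows "movable f us (Suc (card (occupied vs))) (yielding N f us)"
proof -
  let ?a = "LEAST a. movable f us (Suc (card (occupied vs))) a"
  have m: "movable f us (Suc (card (occupied vs))) ?a"
    using movable_exists[OF assms(1)] by (metis LeastI)
  moreover have "?a \<in> {1..N}"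
    using m assms(3) by (auto simp: movable_def)
  ultimately show ?thesis
    by (simp add: yielding_def Let_def assms(2))
qed

lemma one_double_Nil: "one_double [] []"
  by (auto simp: one_double_def position_def)

text \<open>The mover shares its site, so the other explorers still cover all sites, and by counting
  they do so one per site. If the mover lands on an occupied site, this is the new shared site. If
  it lands on a free one, all positions are distinct and the explorer released next coincides with
  the one at the origin.\<close>

lemma one_double_Cons:
  assumes d: "one_double vs us" and a: "movable f us (Suc (card (occupied vs))) a"
  shows "one_double (v # vs) ((a, v) # us)"
proof -
  define k where "k = Suc (card (occupied vs))"
  define pos where "pos = (\<lambda>i. position i us)"
  define pos' where "pos' = (\<lambda>i. position i ((a, v) # us))"
  have pos': "pos' i = (if i = a then pos a + v else pos i)" for i
    by (simp add: pos'_def pos_def position_def)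
  obtain b where ab: "a \<in> {1..k}" "b \<in> {1..k}" "b \<noteq> a" "pos b = pos a"
    using a unfolding movable_def k_def pos_def by blast
  have img: "pos ` {1..k} = occupied vs"
    and tok: "\<And>i j. i \<in> {1..k} \<Longrightarrow> j \<in> {1..k} \<Longrightarrow> i \<noteq> j \<Longrightarrow> pos i = pos j \<Longrightarrow> pos i = token vs"
    and new: "\<And>i. i > k \<Longrightarrow> steps_of i us = []"
    using d by (auto simp: one_double_def Let_def k_def pos_def)
  have pa: "pos a = token vs" using tok[of a b] ab by simp
  have rest: "pos ` ({1..k} - {a}) = occupied vs"
  proof -
    have "pos a \<in> pos ` ({1..k} - {a})" using ab by (intro image_eqI[of _ _ b]) auto
    moreover have "pos ` {1..k} = insert (pos a) (pos ` ({1..k} - {a}))" using ab(1) by blast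
    ultimately show ?thesis using img by (simp add: insert_absorb)
  qed
  have inj: "inj_on pos ({1..k} - {a})"
    by (rule eq_card_imp_inj_on) (use ab rest in \<open>simp_all add: k_def\<close>)
  have "pos' ` ({1..k} - {a}) = pos ` ({1..k} - {a})"
    by (rule image_cong) (auto simp: pos')
  moreover have "pos' ` {1..k} = insert (pos' a) (pos' ` ({1..k} - {a}))" using ab(1) by blast
  ultimately have img': "pos' ` {1..k} = insert (token vs + v) (occupied vs)"
    using rest pa by (simp add: pos')
  show ?thesis
  proof (cases "token vs + v \<in> occupied vs")
    case True
    then have [simp]: "occupied (v # vs) = occupied vs" "token (v # vs) = token vs + v"
      by (auto simp: occupied_Cons insert_absorb token_Cons)
    have "pos' i = token vs + v" if "i \<in> {1..k}" "j \<in> {1..k}" "i \<noteq> j" "pos' i = pos' j" for i j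
    proof (cases "i = a \<or> j = a")
      case False
      then show ?thesis using inj_onD[OF inj, of i j] that by (simp add: pos')
    qed (use that(4) pa in \<open>auto simp: pos'\<close>)
    moreover have "pos' ` {1..k} = occupied vs" using img' True by (simp add: insert_absorb)
    ultimately show ?thesis
      unfolding pos'_def by (intro one_doubleI[where k = k]) (use new ab(1) in \<open>auto simp: k_def\<close>)
  next
    case False
    then have [simp]: "occupied (v # vs) = insert (token vs + v) (occupied vs)" "token (v # vs) = 0"
        "card (insert (token vs + v) (occupied vs)) = k"
      by (auto simp: occupied_Cons token_Cons k_def)
    have new': "pos' (Suc k) = 0"
      using ab(1) new[of "Suc k"] by (auto simp: pos' pos_def position_def)
    have inj': "i = j" if "i \<in> {1..k}" "j \<in> {1..k}" "pos' i = pos' j" for i j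
    proof -
      have ne: "token vs + v \<noteq> pos l" if "l \<in> {1..k}" "l \<noteq> a" for l
        using False rest that by blast
      show ?thesis
      proof (cases "i = a \<or> j = a")
        case True
        then show ?thesis using ne[of i] ne[of j] that pa by (auto simp: pos' split: if_splits)
      next
        case False
        then show ?thesis using inj_onD[OF inj, of i j] that by (simp add: pos')
      qed
    qed
    have "pos' i = 0" if "i \<in> {1..Suc k}" "j \<in> {1..Suc k}" "i \<noteq> j" "pos' i = pos' j" for i j
      using that inj'[of i j] new' by (auto simp: le_Suc_eq)
    moreover have "pos' ` {1..Suc k} = insert (token vs + v) (occupied vs)"
      using img' new' by (simp add: atLeastAtMostSuc_conv insert_absorb)
    ultimately show ?thesis
      unfolding pos'_def by (intro one_doubleI[where k = "Suc k"]) (use new ab(1) in auto)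
  qed
qed

text \<open>The rule never moves an explorer past its settling time: if the two explorers on the
  doubly occupied site could both settle there now, the one of smaller index makes the site part of
  the flashing cluster before the other one is released.\<close>

lemma yielding_coupling:
  fixes S :: "nat \<Rightarrow> nat \<Rightarrow> 'a::ab_group_add"
  assumes N: "0 < N"
    and start: "\<And>i. i \<in> {1..N} \<Longrightarrow> S i 0 = 0"
    and f: "\<And>i p. i \<in> {1..N} \<Longrightarrow> follows (S i) p \<Longrightarrow> f i p \<longleftrightarrow> F i (length p)"
    and settle: "\<And>i. i \<in> {1..N} \<Longrightarrow> F i (\<tau> i)" "\<And>i. i \<in> {1..N} \<Longrightarrow> S i (\<tau> i) \<notin> B (i - 1)"
    and before: "\<And>i t. i \<in> {1..N} \<Longrightarrow> t < \<tau> i \<Longrightarrow> F i t \<Longrightarrow> S i t \<in> B (i - 1)"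
    and B: "\<And>i. i \<in> {1..N} \<Longrightarrow> B i = insert (S i (\<tau> i)) (B (i - 1))"
  defines "vs \<equiv> history S (yielding N f) (completion_step N S (yielding N f))"
  shows "completes N vs"
    and "\<And>i. i \<in> {1..N} \<Longrightarrow> length (steps_of i (schedule (yielding N f) vs)) \<le> \<tau> i"
    and "occupied vs = (\<Union>i\<in>{1..N}. {S i (length (steps_of i (schedule (yielding N f) vs)))})"
proof -
  let ?c = "yielding N f"
  define us where "us n = schedule ?c (history S ?c n)" for n
  define T where "T n i = length (steps_of i (us n))" for n i
  define m where "m n = card (occupied (history S ?c n))" for n
  have fol: "follows (S i) (steps_of i (us n))" if "i \<in> {1..N}" for i n
    unfolding us_def
    by (rule follows_history[where I = "{1..N}"]) (use that yielding_in[OF N] start in auto)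
  have pos: "position i (us n) = S i (T n i)" if "i \<in> {1..N}" for i n
    using follows_end[OF fol[OF that]] by (simp add: position_def T_def)
  have us_Suc: "us (Suc n) = (?c (us n), S (?c (us n)) (Suc (T n (?c (us n)))) - S (?c (us n)) (T n (?c (us n)))) # us n" for n
    by (simp add: us_def Let_def T_def)
  have T_Suc: "T (Suc n) i = (if i = ?c (us n) then Suc (T n i) else T n i)" for n i
    by (simp add: T_def us_Suc)
  have B_mono: "B i \<subseteq> B j" if "i \<le> j" "j \<le> N" for i j
    using that by (induction j) (use B in \<open>fastforce simp: le_Suc_eq\<close>)+
  have inv: "one_double (history S ?c n) (us n) \<and> (\<forall>i\<in>{1..N}. T n i \<le> \<tau> i)"
    if "\<And>l. l < n \<Longrightarrow> m l < N" for n
    using that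
  proof (induction n)
    case 0
    then show ?case by (simp add: one_double_Nil us_def T_def)
  next
    case (Suc n)
    then have IH: "one_double (history S ?c n) (us n)" "\<And>i. i \<in> {1..N} \<Longrightarrow> T n i \<le> \<tau> i"
      by (simp_all add: less_SucI)
    let ?a = "?c (us n)"
    have mn: "m n < N" using Suc.prems by simp
    have mv: "movable f (us n) (Suc (m n)) ?a"
      unfolding m_def by (rule movable_yielding[OF IH(1)]) (use mn in \<open>auto simp: us_def m_def\<close>)
    moreover have "{1..Suc (m n)} \<subseteq> {1..N}" using mn by auto
    ultimately obtain b where b: "?a \<in> {1..N}" "b \<in> {1..N}" "b \<noteq> ?a" "position b (us n) = position ?a (us n)"
        "f ?a (steps_of ?a (us n)) \<longrightarrow> f b (steps_of b (us n)) \<and> b < ?a"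
      unfolding movable_def by blast
    have "T n ?a \<noteq> \<tau> ?a"
    proof
      assume eq: "T n ?a = \<tau> ?a"
      then have "f ?a (steps_of ?a (us n))"
        using f[OF b(1) fol[OF b(1)]] settle(1)[OF b(1)] by (simp add: T_def)
      then have b': "F b (T n b)" "b < ?a"
        using b(5) f[OF b(2) fol[OF b(2)]] by (auto simp: T_def)
      \<comment> \<open>If \<open>b\<close> is at its settling time, it contributes this site
        itself. If it is earlier, \<open>b\<close> flashed here without settling, so the site
        already belonged to the cluster that \<open>b\<close> faces.\<close>
      have "S b (T n b) \<in> B b"
      proof (cases "T n b = \<tau> b")
        case False
        then show ?thesis using before[OF b(2) _ b'(1)] IH(2)[OF b(2)] B[OF b(2)] by auto
      qed (use B[OF b(2)] in auto)
      moreover have "B b \<subseteq> B (?a - 1)" using b'(2) b(1) by (intro B_mono) auto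
      ultimately show False
        using settle(2)[OF b(1)] b(4) pos[OF b(1)] pos[OF b(2)] eq by auto
    qed
    then have "T (Suc n) i \<le> \<tau> i" if "i \<in> {1..N}" for i
      using IH(2)[OF that] IH(2)[OF b(1)] by (auto simp: T_Suc)
    moreover have "one_double (history S ?c (Suc n)) (us (Suc n))"
      using one_double_Cons[OF IH(1)] mv by (simp add: m_def us_def Let_def)
    ultimately show ?case by blast
  qed
  have sumT: "(\<Sum>i\<in>{1..N}. T n i) = n" for n
  proof (induction n)
    case (Suc n)
    have "(\<Sum>i\<in>{1..N}. T (Suc n) i) = (\<Sum>i\<in>{1..N}. T n i + (if i = ?c (us n) then 1 else 0))"
      by (rule sum.cong) (auto simp: T_Suc)
    then show ?case using Suc yielding_in[OF N, of f "us n"] by (simp add: sum.distrib del: One_nat_def)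
  qed (simp add: T_def us_def)
  \<comment> \<open>The clocks sum to \<open>n\<close>, since each step advances exactly one of
    them. If \<open>N\<close> sites were never occupied, every clock would stay below its settling
    time and \<open>n\<close> would be bounded.\<close>
  obtain n where n: "N \<le> m n"
  proof (rule ccontr)
    assume "\<not> thesis"
    then have "m n < N" for n using that not_le by blast
    then have "T n i \<le> \<tau> i" if "i \<in> {1..N}" for n i using inv that by blast
    then have "(\<Sum>i\<in>{1..N}. T n i) \<le> (\<Sum>i\<in>{1..N}. \<tau> i)" for n by (rule sum_mono)
    from this[of "Suc (\<Sum>i\<in>{1..N}. \<tau> i)"] show False unfolding sumT by simp
  qed
  let ?s = "completion_step N S ?c"
  show compl: "completes N vs"
    unfolding vs_def using completes_history(1)[of N S ?c n] n N by (simp add: m_def)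
  have "m l < N" if "l < ?s" for l
  proof (rule ccontr)
    assume "\<not> m l < N"
    then have "?s \<le> l" using completes_history(2)[of N S ?c l] N by (simp add: m_def)
    then show False using that by simp
  qed
  then have dbl: "one_double vs (us ?s)" and le: "\<And>i. i \<in> {1..N} \<Longrightarrow> T ?s i \<le> \<tau> i"
    using inv[of ?s] by (auto simp: vs_def)
  show "length (steps_of i (schedule ?c vs)) \<le> \<tau> i" if "i \<in> {1..N}" for i
    using le[OF that] by (simp add: T_def us_def vs_def)
  have card: "card (occupied vs) = N" using compl by (simp add: completes_def)
  have "i \<le> N" if "i \<in> set (map fst (us n))" for i n
    using that fst_schedule_in[of ?c "{1..N}", OF yielding_in[OF N]] by (force simp: us_def)
  then have "filter (\<lambda>u. fst u = Suc N) (us ?s) = []"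
    by (force simp: filter_empty_conv)
  then have last: "position (Suc N) (us ?s) = 0" by (simp add: position_def steps_of_def)
  have img: "(\<lambda>i. position i (us ?s)) ` {1..Suc N} = occupied vs"
    using dbl card by (simp add: one_double_def Let_def)
  \<comment> \<open>At completion the invariant counts \<open>N + 1\<close> explorers, the last of
    which is fictitious and sits at the origin. Omitting it loses no site: either no step was made
    or the last step added a site, so the token is 0, and a true explorer takes part in any
    collision.\<close>
  have "0 \<in> (\<lambda>i. position i (us ?s)) ` {1..N}"
  proof -
    obtain i j where ij: "i \<in> {1..Suc N}" "j \<in> {1..Suc N}" "i < j"
        "position i (us ?s) = position j (us ?s)"
      using one_double_collision[OF dbl] card by (metis linorder_neqE_nat)
    have "position i (us ?s) = 0"
    proof (cases "j = Suc N")
      case False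
      have "token vs = 0"
      proof (cases vs)
        case (Cons v vs')
        then show ?thesis using compl
          by (auto simp: completes_def token_Cons card_occupied_Cons split: if_splits)
      qed simp
      moreover have "\<forall>i\<in>{1..Suc N}. \<forall>j\<in>{1..Suc N}. i \<noteq> j \<and>
          position i (us ?s) = position j (us ?s) \<longrightarrow> position i (us ?s) = token vs"
        using dbl unfolding one_double_def Let_def card by blast
      ultimately show ?thesis using ij less_imp_neq by metis
    qed (use ij last in simp)
    then show ?thesis using ij by (intro image_eqI[of _ _ i]) auto
  qed
  then have "(\<lambda>i. position i (us ?s)) ` {1..N} = occupied vs"
    using img last by (simp add: atLeastAtMostSuc_conv insert_absorb)
  moreover have "(\<lambda>i. position i (us ?s)) ` {1..N} = (\<Union>i\<in>{1..N}. {S i (T ?s i)})"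
    using pos by auto
  ultimately show "occupied vs = (\<Union>i\<in>{1..N}. {S i (length (steps_of i (schedule ?c vs)))})"
    by (simp add: T_def us_def vs_def)
qed

section \<open>Law of scheduled walks\<close>

lemma measurable_schedule:
  fixes c :: "'w \<Rightarrow> (nat \<times> 'a::countable) list \<Rightarrow> nat"
  assumes "\<And>us. (\<lambda>w. c w us) \<in> measurable G (count_space UNIV)"
  shows "(\<lambda>w. schedule (c w) vs) \<in> measurable G (count_space UNIV)"
proof (induction vs)
  case (Cons v vs)
  have "(\<lambda>w. (c w us, v) # us) \<in> measurable G (count_space UNIV)" for us
    by (rule measurable_compose[OF assms]) simp
  from measurable_compose_countable[OF this Cons] show ?case by simp
qed simp

text \<open>The probability that a simple random walk begins with the steps \<open>p\<close>; it is
  0 if one of them is not a unit step.\<close>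

definition step_weight :: "(int ^ 'd::finite) list \<Rightarrow> real" where
  "step_weight p = (\<Prod>v\<leftarrow>p. pmf (pmf_of_set unit_steps) v)"

lemma step_weight_nonneg: "0 \<le> step_weight p"
  unfolding step_weight_def by (induction p) auto

text \<open>This is where the schedule drops out: whichever walk makes a step, the step contributes
  the same factor.\<close>

lemma prod_step_weight_steps_of:
  assumes "fst ` set us \<subseteq> I" "finite I"
  shows "(\<Prod>i\<in>I. step_weight (steps_of i us)) = step_weight (map snd us)"
  using assms(1)
proof (induction us)
  case (Cons u us)
  have "(\<Prod>i\<in>I. step_weight (steps_of i (u # us))) =
      (\<Prod>i\<in>I. (if i = fst u then pmf (pmf_of_set unit_steps) (snd u) else 1) * step_weight (steps_of i us))"
    by (rule prod.cong) (auto simp: step_weight_def)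
  also have "\<dots> = pmf (pmf_of_set unit_steps) (snd u) * step_weight (map snd us)"
    using Cons assms(2) by (simp add: prod.distrib)
  finally show ?case by (simp add: step_weight_def)
qed (simp add: step_weight_def)

text \<open>The rule \<open>c\<close> chooses the walk that makes the next step; \<open>G\<close> carries the randomness, independent of
  the walks, that it may use besides the steps made so far.\<close>

locale scheduled_walks = prob_space M
  for M :: "'w measure" and N :: nat and W :: "nat \<Rightarrow> 'w \<Rightarrow> nat \<Rightarrow> int ^ 'd::finite"
    and G :: "'w measure" and c :: "'w \<Rightarrow> (nat \<times> (int ^ 'd)) list \<Rightarrow> nat" +
  assumes space_G: "space G = space M" and sets_G: "sets G \<subseteq> sets M"
    and c_meas: "\<And>us. (\<lambda>w. c w us) \<in> measurable G (count_space UNIV)"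
    and c_range: "\<And>w us. c w us \<in> {1..N}"
    and W_meas: "\<And>i t. i \<in> {1..N} \<Longrightarrow> (\<lambda>w. W i w t) \<in> measurable M (count_space UNIV)"
    and W_indep: "\<And>C p. C \<in> sets G \<Longrightarrow>
      prob (C \<inter> {w \<in> space M. \<forall>i\<in>{1..N}. follows (W i w) (p i)}) =
      prob C * (\<Prod>i\<in>{1..N}. step_weight (p i))"
begin

definition obeys :: "'w \<Rightarrow> (int ^ 'd) list \<Rightarrow> bool" where
  "obeys w vs \<longleftrightarrow> (\<forall>i\<in>{1..N}. follows (W i w) (steps_of i (schedule (c w) vs)))"

lemma measurable_G: "f \<in> measurable G K \<Longrightarrow> f \<in> measurable M K"
  using sets_G space_G by (auto simp: measurable_def)

lemma schedule_meas: "(\<lambda>w. schedule (c w) vs) \<in> measurable G (count_space UNIV)"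
  by (rule measurable_schedule[OF c_meas])

lemma pred_follows: "i \<in> {1..N} \<Longrightarrow> Measurable.pred M (\<lambda>w. follows (W i w) p)"
proof (induction p)
  case Nil
  note [measurable] = W_meas[OF Nil]
  show ?case by simp
next
  case (Cons v p)
  note [measurable] = W_meas[OF Cons.prems] Cons.IH[OF Cons.prems]
  show ?case by simp
qed

lemma pred_obeys: "Measurable.pred M (\<lambda>w. obeys w vs)"
proof -
  have "Measurable.pred M (\<lambda>w. \<forall>i\<in>{1..N}. follows (W i w) (steps_of i us))" for us
    by (intro pred_intros_finite pred_follows) auto
  then show ?thesis
    unfolding obeys_def
    by (rule measurable_compose_countable[OF _ measurable_G[OF schedule_meas]])
qed

text \<open>The event is split by the value of the schedule, which is measurable for
  \<open>G\<close> and has countably many values. On each part the walks have to follow given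
  pieces, and independence yields the same factor \<open>step_weight vs\<close> every time.\<close>

lemma prob_obeys: "prob {w \<in> space M. obeys w vs} = step_weight vs"
proof -
  let ?Z = "\<lambda>us. {w \<in> space M. schedule (c w) vs = us}"
  let ?F = "\<lambda>us. {w \<in> space M. \<forall>i\<in>{1..N}. follows (W i w) (steps_of i us)}"
  have Z: "?Z us \<in> sets G" for us
    using measurable_sets[OF schedule_meas, of "{us}" vs] by (simp add: space_G vimage_def Int_def conj_commute)
  have F: "?F us \<in> sets M" for us
    unfolding pred_def[symmetric] by (intro pred_intros_finite pred_follows) auto
  have eq: "emeasure M (?Z us \<inter> ?F us) = ennreal (step_weight vs) * emeasure M (?Z us)" for us
  proof (cases "?Z us = {}")
    case False
    \<comment> \<open>A sample point in the part shows that \<open>us\<close> is a labelling of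
      \<open>vs\<close> by indices in \<open>{1..N}\<close>, as the regrouping of the weights
      requires.\<close>
    then obtain w where us: "us = schedule (c w) vs" by auto
    have "(\<Prod>i\<in>{1..N}. step_weight (steps_of i us)) = step_weight (map snd us)"
      by (rule prod_step_weight_steps_of)
        (use fst_schedule_in[of "c w" "{1..N}", OF c_range] in \<open>auto simp: us\<close>)
    then have "(\<Prod>i\<in>{1..N}. step_weight (steps_of i us)) = step_weight vs" by (simp add: us)
    then show ?thesis
      using W_indep[OF Z, of us "\<lambda>i. steps_of i us"]
      by (simp add: emeasure_eq_measure ennreal_mult' step_weight_nonneg mult.commute)
  qed (simp only: Int_empty_left emeasure_empty mult_zero_right)
  have "emeasure M {w \<in> space M. obeys w vs} = emeasure M (\<Union>us. ?Z us \<inter> ?F us)"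
    by (rule arg_cong[where f = "emeasure M"]) (auto simp: obeys_def)
  also have "\<dots> = (\<integral>\<^sup>+ us. emeasure M (?Z us \<inter> ?F us) \<partial>count_space UNIV)"
    by (rule emeasure_UN_countable) (use Z F sets_G in \<open>auto simp: disjoint_family_on_def\<close>)
  also have "\<dots> = (\<integral>\<^sup>+ us. ennreal (step_weight vs) * emeasure M (?Z us) \<partial>count_space UNIV)"
    by (simp only: eq)
  also have "\<dots> = ennreal (step_weight vs) * (\<integral>\<^sup>+ us. emeasure M (?Z us) \<partial>count_space UNIV)"
    by (rule nn_integral_cmult) simp
  also have "(\<integral>\<^sup>+ us. emeasure M (?Z us) \<partial>count_space UNIV) = emeasure M (\<Union>us. ?Z us)"
    by (rule emeasure_UN_countable[symmetric]) (use Z sets_G in \<open>auto simp: disjoint_family_on_def\<close>)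
  also have "(\<Union>us. ?Z us) = space M" by auto
  finally show ?thesis
    by (simp add: prob_space emeasure_eq_measure step_weight_nonneg)
qed

definition finishes :: "'w \<Rightarrow> (int ^ 'd) list \<Rightarrow> bool" where
  "finishes w vs \<longleftrightarrow> completes N vs \<and> obeys w vs"

lemma finishes_unique: "finishes w vs \<Longrightarrow> finishes w vs' \<Longrightarrow> vs = vs'"
  unfolding finishes_def obeys_def
  by (rule completes_unique[where I = "{1..N}" and c = "c w" and W = "\<lambda>i. W i w" and N = N])
    (use c_range in auto)

text \<open>By \<open>finishes_unique\<close> the events for different completing streams are
  disjoint. The resulting sum contains neither the rule nor the extra randomness, so any two
  schedules give the occupied set the same law.\<close>

lemma emeasure_finishes:
  "emeasure M {w \<in> space M. \<exists>vs. finishes w vs \<and> occupied vs \<in> D} =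
     (\<integral>\<^sup>+ vs. ennreal (step_weight vs) \<partial>count_space {vs. completes N vs \<and> occupied vs \<in> D})"
proof -
  let ?I = "{vs. completes N vs \<and> occupied vs \<in> D}"
  have "{w \<in> space M. \<exists>vs. finishes w vs \<and> occupied vs \<in> D} = (\<Union>vs\<in>?I. {w \<in> space M. obeys w vs})"
    by (auto simp: finishes_def)
  also have "emeasure M \<dots> = (\<integral>\<^sup>+ vs. emeasure M {w \<in> space M. obeys w vs} \<partial>count_space ?I)"
    by (rule emeasure_UN_countable)
      (use pred_obeys finishes_unique in \<open>auto simp: disjoint_family_on_def finishes_def pred_def\<close>)
  finally show ?thesis by (simp add: emeasure_eq_measure prob_obeys)
qed

lemma emeasure_cluster:
  assumes "AE w in M. \<exists>vs. finishes w vs" "A \<in> measurable M (count_space UNIV)"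
    and "\<And>w vs. w \<in> space M \<Longrightarrow> finishes w vs \<Longrightarrow> A w = occupied vs"
  shows "emeasure (distr M (count_space UNIV) A) D =
     (\<integral>\<^sup>+ vs. ennreal (step_weight vs) \<partial>count_space {vs. completes N vs \<and> occupied vs \<in> D})"
proof -
  have "{w \<in> space M. \<exists>vs. finishes w vs \<and> occupied vs \<in> D} =
      (\<Union>vs\<in>{vs. completes N vs \<and> occupied vs \<in> D}. {w \<in> space M. obeys w vs})"
    by (auto simp: finishes_def)
  also have "\<dots> \<in> sets M"
    by (rule sets.countable_UN') (use pred_obeys in \<open>auto simp: pred_def\<close>)
  finally have meas: "{w \<in> space M. \<exists>vs. finishes w vs \<and> occupied vs \<in> D} \<in> sets M" .
  have "emeasure (distr M (count_space UNIV) A) D = emeasure M (A -` D \<inter> space M)"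
    by (rule emeasure_distr[OF assms(2)]) simp
  also have "\<dots> = emeasure M {w \<in> space M. \<exists>vs. finishes w vs \<and> occupied vs \<in> D}"
  proof (rule emeasure_eq_AE)
    show "AE w in M. w \<in> A -` D \<inter> space M \<longleftrightarrow>
        w \<in> {w \<in> space M. \<exists>vs. finishes w vs \<and> occupied vs \<in> D}"
      using assms(1) AE_space
    proof eventually_elim
      case (elim w)
      then obtain vs where "finishes w vs" "A w = occupied vs" using assms(3) by blast
      then show ?case using elim finishes_unique by auto
    qed
  qed (use meas measurable_sets[OF assms(2)] in auto)
  finally show ?thesis by (simp add: emeasure_finishes)
qed

text \<open>The right-hand side knows nothing of the space, the walks or the rule. Hence almost sure
  completion passes from one scheduled system to any other.\<close>

lemma AE_finishes_iff:
  "(AE w in M. \<exists>vs. finishes w vs) \<longleftrightarrow>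
     (\<integral>\<^sup>+ vs. ennreal (step_weight vs) \<partial>count_space {vs :: (int ^ 'd) list. completes N vs}) = 1"
proof -
  have "{w \<in> space M. \<exists>vs. finishes w vs} = (\<Union>vs\<in>{vs. completes N vs}. {w \<in> space M. obeys w vs})"
    by (auto simp: finishes_def)
  also have "\<dots> \<in> sets M"
    by (rule sets.countable_UN') (use pred_obeys in \<open>auto simp: pred_def\<close>)
  finally have "{w \<in> space M. \<exists>vs. finishes w vs} \<in> sets M" .
  then have "(AE w in M. \<exists>vs. finishes w vs) \<longleftrightarrow> emeasure M {w \<in> space M. \<exists>vs. finishes w vs} = 1"
    by (simp add: prob_Collect_eq_1 emeasure_eq_measure)
  also have "emeasure M {w \<in> space M. \<exists>vs. finishes w vs} =
     (\<integral>\<^sup>+ vs. ennreal (step_weight vs) \<partial>count_space {vs :: (int ^ 'd) list. completes N vs})"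
    using emeasure_finishes[of UNIV] by simp
  finally show ?thesis .
qed

end

section \<open>Flashing times\<close>

definition flashes ::
  "(nat \<Rightarrow> nat) \<Rightarrow> (nat \<Rightarrow> int ^ 'd::finite) \<Rightarrow> (nat \<Rightarrow> bool) \<Rightarrow> (nat \<Rightarrow> bool) \<Rightarrow> (nat \<Rightarrow> real)
    \<Rightarrow> nat \<Rightarrow> bool" where
  "flashes h S x y \<rho> t \<longleftrightarrow> (\<exists>j a. arrival_time h j S = enat a \<and>
     candidate_time h S x y \<rho> j = enat t \<and> S t \<in> cell h j (S a))"

text \<open>Seen as the first time at which a Boolean process is true, the settling time inherits
  its characterisation, finiteness and measurability from hitting times.\<close>

lemma settling_time_eq_hitting_time:
  "settling_time h S x y \<rho> A = hitting_time {True} (\<lambda>t. flashes h S x y \<rho> t \<and> S t \<notin> A)"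
  unfolding settling_time_def hitting_time_def flashes_def
  by (rule arg_cong[where f = Inf]) auto

lemma settling_time_eq_enat:
  "settling_time h S x y \<rho> A = enat t \<longleftrightarrow>
     flashes h S x y \<rho> t \<and> S t \<notin> A \<and> (\<forall>s<t. flashes h S x y \<rho> s \<longrightarrow> S s \<in> A)"
  unfolding settling_time_eq_hitting_time hitting_time_eq_enat by auto

text \<open>All exit conditions of \<open>flash_delay\<close> in one predicate of the starting site
  \<open>z\<close> and the current site \<open>v\<close>, so that measurability can be checked for
  given \<open>z\<close> and \<open>v\<close>.\<close>

definition stops ::
  "(nat \<Rightarrow> nat) \<Rightarrow> nat \<Rightarrow> bool \<Rightarrow> bool \<Rightarrow> real \<Rightarrow> int ^ 'd::finite \<Rightarrow> int ^ 'd \<Rightarrow> bool" where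
  "stops h j x y \<rho> z v \<longleftrightarrow> x \<or>
     (if y then v \<notin> lattice_ball z (min \<rho> (real (radius h j) + real (h j) - norm (rvec z)))
      else v \<notin> lattice_annulus (real (radius h j) - \<rho>) (real (radius h j) + \<rho>))"

lemma flash_delay_eq_hitting_time:
  "flash_delay h j x y \<rho> S = hitting_time {True} (\<lambda>t. stops h j x y \<rho> (S 0) (S t))"
proof (cases x)
  case True
  then have "hitting_time {True} (\<lambda>t. stops h j x y \<rho> (S 0) (S t)) = enat 0"
    unfolding hitting_time_eq_enat by (simp add: stops_def)
  then show ?thesis using True by (simp add: flash_delay_def zero_enat_def)
qed (auto simp: flash_delay_def stops_def hitting_time_def)

lemma candidate_time_eq_enat:
  "candidate_time h S x y \<rho> j = enat t \<longleftrightarrow>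
     (\<exists>a b. t = a + b \<and> arrival_time h j S = enat a \<and> stops h j (x j) (y j) (\<rho> j) (S a) (S (a + b)) \<and>
        (\<forall>c<b. \<not> stops h j (x j) (y j) (\<rho> j) (S a) (S (a + c))))"
proof (cases "arrival_time h j S")
  case (enat a)
  have "candidate_time h S x y \<rho> j = enat t \<longleftrightarrow>
      (\<exists>b. t = a + b \<and> flash_delay h j (x j) (y j) (\<rho> j) (\<lambda>t. S (a + t)) = enat b)"
    by (cases "flash_delay h j (x j) (y j) (\<rho> j) (\<lambda>t. S (a + t))")
      (auto simp: candidate_time_def enat)
  then show ?thesis
    using enat by (auto simp: flash_delay_eq_hitting_time hitting_time_eq_enat)
qed (simp add: candidate_time_def)

text \<open>Only positions up to time \<open>t\<close> occur on the right, so a flash is decided by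
  the past and the coins. The right-hand side is also a countable combination of conditions at given
  times, as measurability requires.\<close>

lemma flashes_iff:
  "flashes h S x y \<rho> t \<longleftrightarrow> (\<exists>j. \<exists>a\<le>t. S a \<in> sphere_sites h j \<and> (\<forall>s<a. S s \<notin> sphere_sites h j) \<and>
     stops h j (x j) (y j) (\<rho> j) (S a) (S t) \<and>
     (\<forall>s\<in>{a..<t}. \<not> stops h j (x j) (y j) (\<rho> j) (S a) (S s)) \<and> S t \<in> cell h j (S a))"
proof -
  have shift: "(\<forall>c<b. \<not> P (a + c)) \<longleftrightarrow> (\<forall>s\<in>{a..<a + b}. \<not> P s)" for P and a b :: nat
  proof
    assume L: "\<forall>c<b. \<not> P (a + c)"
    show "\<forall>s\<in>{a..<a + b}. \<not> P s"
    proof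
      fix s assume "s \<in> {a..<a + b}"
      then obtain c where "s = a + c" "c < b" by (auto simp: le_iff_add)
      then show "\<not> P s" using L by blast
    qed
  qed auto
  show ?thesis (is "_ \<longleftrightarrow> (\<exists>j. \<exists>a\<le>t. ?P j a)")
  proof
    assume "flashes h S x y \<rho> t"
    then obtain j a b where "arrival_time h j S = enat a" "t = a + b" "S t \<in> cell h j (S a)"
        "stops h j (x j) (y j) (\<rho> j) (S a) (S (a + b))"
        "\<forall>c<b. \<not> stops h j (x j) (y j) (\<rho> j) (S a) (S (a + c))"
      by (auto simp: flashes_def candidate_time_eq_enat)
    then have "a \<le> t \<and> ?P j a"
      using shift[of b "\<lambda>s. stops h j (x j) (y j) (\<rho> j) (S a) (S s)" a]
      by (simp add: arrival_time_def hitting_time_eq_enat)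
    then show "\<exists>j. \<exists>a\<le>t. ?P j a" by blast
  next
    assume "\<exists>j. \<exists>a\<le>t. ?P j a"
    then obtain j a b where b: "t = a + b" "?P j a" by (auto simp: le_iff_add)
    then have "arrival_time h j S = enat a" by (simp add: arrival_time_def hitting_time_eq_enat)
    moreover from this b have "candidate_time h S x y \<rho> j = enat t"
      using shift[of b "\<lambda>s. stops h j (x j) (y j) (\<rho> j) (S a) (S s)" a]
      unfolding candidate_time_eq_enat by blast
    ultimately show "flashes h S x y \<rho> t" using b unfolding flashes_def by blast
  qed
qed

lemma flashes_cong:
  assumes "\<And>s. s \<le> t \<Longrightarrow> S s = S' s"
  shows "flashes h S x y \<rho> t \<longleftrightarrow> flashes h S' x y \<rho> t"
  unfolding flashes_iff using assms by (intro ex_cong1 conj_cong refl) auto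

section \<open>Favourable shells and finiteness of settling times\<close>

lemma rvec_diff: "rvec (x - y) = rvec x - rvec y"
  by (simp add: rvec_def vec_eq_iff)

lemma rvec_zero [simp]: "rvec 0 = 0"
  by (simp add: rvec_def vec_eq_iff)

lemma radius_ge: "(\<And>j. h j > 0) \<Longrightarrow> j \<le> radius h j"
proof (induction j)
  case (Suc j)
  have "j \<le> radius h j" "0 < h j" using Suc by blast+
  then show ?case by simp
qed simp

text \<open>Either event forces a flash in shell \<open>j\<close>, and its probability is bounded below uniformly in \<open>j\<close>:
  for small \<open>h j\<close> the coin \<open>X\<close> is used, otherwise the exit point of a ball of radius at most \<open>h j / 4\<close>
  is closer than \<open>h j / 2\<close> to its centre.\<close>

definition favourable :: "(nat \<Rightarrow> nat) \<Rightarrow> (nat \<Rightarrow> bool) \<Rightarrow> (nat \<Rightarrow> bool) \<Rightarrow> (nat \<Rightarrow> real) \<Rightarrow> nat \<Rightarrow> bool" where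
  "favourable h x y \<rho> j \<longleftrightarrow> (if h j \<le> 4 then x j else y j \<and> \<rho> j \<le> real (h j) / 4)"

text \<open>What the geometric argument needs from a walk. For such a trajectory, finiteness of the
  settling time becomes a deterministic statement about the coins.\<close>

definition escaping :: "(nat \<Rightarrow> int ^ 'd::finite) \<Rightarrow> bool" where
  "escaping S \<longleftrightarrow> S 0 = 0 \<and> (\<forall>t. norm (rvec (S (Suc t)) - rvec (S t)) = 1) \<and>
     (\<forall>n. \<exists>t. real n < norm (rvec (S t)))"

text \<open>A distance larger than all those reached up to time \<open>a\<close> can only be
  attained after \<open>a\<close>.\<close>

lemma escaping_late:
  assumes "escaping S" shows "\<exists>t. r < norm (rvec (S (a + t)))"
proof -
  define m where "m = Max ((\<lambda>t. norm (rvec (S t))) ` {..a})"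
  obtain n where "max r m < real n" using reals_Archimedean2 by blast
  moreover obtain t where "real n < norm (rvec (S t))" using assms unfolding escaping_def by blast
  ultimately have t: "max r m < norm (rvec (S t))" by simp
  have "\<not> t \<le> a"
  proof
    assume "t \<le> a"
    then have "norm (rvec (S t)) \<le> m" unfolding m_def by (intro Max_ge) auto
    then show False using t by simp
  qed
  then show ?thesis using t by (intro exI[of _ "t - a"]) auto
qed

text \<open>The inner radius of shell \<open>Suc i\<close> is at least \<open>i\<close>. The lower
  bound on the norm of the flash site is the point of the lemma: it places the flash outside any
  given finite cluster once \<open>i\<close> is large.\<close>

lemma favourable_flash:
  assumes h: "\<And>j. h j > 0" and S: "escaping S" and fav: "favourable h x y \<rho> (Suc i)"
  shows "\<exists>t. flashes h S x y \<rho> t \<and> real i \<le> norm (rvec (S t))"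
proof -
  let ?j = "Suc i"
  define r where "r = real (radius h ?j)"
  define H where "H = real (h ?j)"
  have H1: "H \<ge> 1" using h[of ?j] by (simp add: H_def)
  have rH: "r - H \<ge> real i" using radius_ge[of h i, OF h] by (simp add: r_def H_def)
  have step: "norm (rvec (S (Suc t)) - rvec (S t)) = 1" for t using S by (simp add: escaping_def)
  \<comment> \<open>With steps of length 1, the first site at distance at least \<open>r\<close> has
    a neighbour in the ball and so lies on its outer boundary. Thus the walk visits the sphere and
    has an arrival time.\<close>
  let ?t = "LEAST t. r \<le> norm (rvec (S t))"
  have ex: "\<exists>t. r \<le> norm (rvec (S t))" using escaping_late[OF S, of r 0] less_imp_le by auto
  have t: "r \<le> norm (rvec (S ?t))" by (rule LeastI_ex[OF ex])
  have "?t \<noteq> 0"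
  proof
    assume "?t = 0"
    then show False using t S H1 rH by (simp add: escaping_def)
  qed
  then obtain u where u: "?t = Suc u" by (cases ?t) auto
  have "norm (rvec (S u)) < r" using not_less_Least[of u "\<lambda>t. r \<le> norm (rvec (S t))"] u by simp
  then have "S ?t \<in> sphere_sites h ?j"
    using t step[of u] u
    by (auto simp: sphere_sites_def outer_boundary_def lattice_ball_def r_def[symmetric] dist_norm
        simp del: radius.simps intro!: bexI[of _ "S u"])
  then obtain a where a: "arrival_time h ?j S = enat a"
    unfolding arrival_time_def using hitting_time_finite by blast
  define z where "z = S a"
  have "z \<in> sphere_sites h ?j"
    using a by (simp add: arrival_time_def hitting_time_eq_enat z_def)
  then obtain z' where z': "r \<le> norm (rvec z)" "norm (rvec z') < r" "norm (rvec z - rvec z') = 1"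
    by (auto simp: sphere_sites_def outer_boundary_def lattice_ball_def r_def[symmetric] dist_norm
        simp del: radius.simps)
  have z: "r \<le> norm (rvec z)" "norm (rvec z) < r + 1"
    using z' norm_triangle_ineq[of "rvec z'" "rvec z - rvec z'"] by auto
  have cell: "v \<in> cell h ?j z" if "norm (rvec v - rvec z) < H / 2" "r - H \<le> norm (rvec v)" "norm (rvec v) < r + H" for v
  proof -
    have "\<exists>c\<ge>0. \<exists>y\<in>ball (rvec z) (H / 2). rvec v = c *\<^sub>R y"
      using that(1) by (intro exI[of _ 1] conjI bexI[of _ "rvec v"]) (auto simp: dist_norm norm_minus_commute)
    then show ?thesis
      using that(2,3) by (simp add: cell_def shell_def lattice_annulus_def r_def[symmetric] H_def[symmetric] del: radius.simps)
  qed
  define P where "P t \<longleftrightarrow> stops h ?j (x ?j) (y ?j) (\<rho> ?j) z (S (a + t))" for t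
  have flash: "flashes h S x y \<rho> (a + b)"
    if "P b" "\<And>c. c < b \<Longrightarrow> \<not> P c" "S (a + b) \<in> cell h ?j z" for b
    unfolding flashes_def candidate_time_eq_enat using a that unfolding P_def z_def by blast
  show ?thesis
  proof (cases "x ?j")
    case True
    \<comment> \<open>The centre lies in its shell because its norm is below r + 1 and H is at least
      1.\<close>
    have "z \<in> cell h ?j z" by (rule cell) (use z H1 in auto)
    then have "flashes h S x y \<rho> (a + 0)" using True by (intro flash) (auto simp: P_def stops_def z_def)
    moreover have "real i \<le> norm (rvec (S a))" using z rH H1 by (simp add: z_def)
    ultimately show ?thesis by auto
  next
    case False
    then have big: "4 < h ?j" "y ?j" "\<rho> ?j \<le> H / 4"
      using fav by (auto simp: favourable_def H_def split: if_splits)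
    then have H5: "H \<ge> 5" by (simp add: H_def)
    define R where "R = min (\<rho> ?j) (r + H - norm (rvec z))"
    have P: "P t \<longleftrightarrow> R \<le> norm (rvec (S (a + t)) - rvec z)" for t
      using False big(2) by (auto simp: P_def stops_def lattice_ball_def R_def r_def H_def dist_norm
          norm_minus_commute not_less simp del: radius.simps)
    obtain t where "H + norm (rvec z) < norm (rvec (S (a + t)))" using escaping_late[OF S] by blast
    then have "P t"
      using norm_triangle_ineq2[of "rvec (S (a + t))" "rvec z"] big(3) H1 unfolding P R_def by linarith
    then obtain b where b: "P b" "\<And>c. c < b \<Longrightarrow> \<not> P c"
      using exists_least_iff[of P] by blast
    \<comment> \<open>The last site before the exit is within H / 4 of the centre and one step adds
      1; an exit at time 0 is the centre itself. For H > 4 the bound H / 4 + 1 is below H / 2, and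
      it keeps the exit site inside the shell since the centre has norm in [r, r + 1).\<close>
    have d: "norm (rvec (S (a + b)) - rvec z) < H / 4 + 1"
    proof (cases b)
      case 0
      then show ?thesis using H1 by (simp add: z_def)
    next
      case (Suc c)
      have "norm (rvec (S (a + c)) - rvec z) < H / 4"
        using b(2)[of c] Suc big(3) unfolding P R_def by simp
      then show ?thesis
        using step[of "a + c"] norm_triangle_ineq[of "rvec (S (a + b)) - rvec (S (a + c))" "rvec (S (a + c)) - rvec z"] Suc
        by simp
    qed
    have n: "norm (rvec z) - norm (rvec (S (a + b)) - rvec z) \<le> norm (rvec (S (a + b)))"
      "norm (rvec (S (a + b))) \<le> norm (rvec z) + norm (rvec (S (a + b)) - rvec z)"
      using norm_triangle_ineq2[of "rvec z" "rvec (S (a + b))"] norm_triangle_ineq[of "rvec z" "rvec (S (a + b)) - rvec z"]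
      by (simp_all add: norm_minus_commute)
    have "S (a + b) \<in> cell h ?j z" by (rule cell) (use d n z H5 in linarith)+
    then have "flashes h S x y \<rho> (a + b)" using b by (intro flash)
    moreover have "real i \<le> norm (rvec (S (a + b)))" using d n z rH H5 by linarith
    ultimately show ?thesis by blast
  qed
qed

text \<open>A finite cluster lies in some ball, and a favourable shell beyond that ball produces a
  flash outside the cluster.\<close>

lemma settling_time_finite:
  assumes h: "\<And>j. h j > 0" and S: "escaping S" and fav: "\<exists>\<^sub>\<infinity>j. favourable h x y \<rho> j" and "finite A"
  shows "\<exists>t. settling_time h S x y \<rho> A = enat t"
proof -
  define m where "m = Max (insert 0 ((\<lambda>v. norm (rvec v)) ` A))"
  have m: "norm (rvec v) \<le> m" if "v \<in> A" for v
    unfolding m_def using that \<open>finite A\<close> by (intro Max_ge) auto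
  obtain k where k: "m < real k" using reals_Archimedean2 by blast
  obtain j where j: "j > k" "favourable h x y \<rho> j"
    using fav by (auto simp: INFM_nat)
  then obtain i where i: "j = Suc i" "k \<le> i" by (cases j) auto
  obtain t where "flashes h S x y \<rho> t" "real i \<le> norm (rvec (S t))"
    using favourable_flash[of h S x y \<rho> i, OF h S] j i by blast
  moreover then have "S t \<notin> A" using m[of "S t"] k i by auto
  ultimately show ?thesis
    unfolding settling_time_eq_hitting_time
    using hitting_time_finite[of "\<lambda>t. flashes h S x y \<rho> t \<and> S t \<notin> A" t "{True}"] by auto
qed

text \<open>Positions take countably many values, so \<open>stops\<close> and \<open>cell\<close>
  only have to be examined for given sites.\<close>

lemma pred_flashes:
  fixes S :: "'w \<Rightarrow> nat \<Rightarrow> int ^ 'd::finite"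
  assumes S [measurable]: "\<And>t. (\<lambda>w. S w t) \<in> measurable M (count_space UNIV)"
    and X [measurable]: "\<And>j. Measurable.pred M (\<lambda>w. X w j)"
    and Y [measurable]: "\<And>j. Measurable.pred M (\<lambda>w. Y w j)"
    and R [measurable]: "\<And>j. (\<lambda>w. R w j) \<in> borel_measurable M"
  shows "Measurable.pred M (\<lambda>w. flashes h (S w) (X w) (Y w) (R w) t)"
proof -
  have st: "Measurable.pred M (\<lambda>w. stops h j (X w j) (Y w j) (R w j) z v)" for j and z v :: "int ^ 'd"
    unfolding stops_def lattice_ball_def lattice_annulus_def by simp
  have st [measurable]: "Measurable.pred M (\<lambda>w. stops h j (X w j) (Y w j) (R w j) (S w a) (S w s))" for j a s
  proof -
    have "Measurable.pred M (\<lambda>w. stops h j (X w j) (Y w j) (R w j) (S w a) v)" for v :: "int ^ 'd"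
      by (rule measurable_compose_countable[OF _ S[of a]]) (rule st)
    then show ?thesis by (rule measurable_compose_countable[OF _ S[of s]])
  qed
  have [measurable]: "Measurable.pred M (\<lambda>w. S w t \<in> cell h j (S w a))" for j a
  proof -
    have "Measurable.pred M (\<lambda>w. S w t \<in> cell h j v)" for v by simp
    then show ?thesis by (rule measurable_compose_countable[OF _ S[of a]])
  qed
  show ?thesis unfolding flashes_iff by measurable
qed

section \<open>Simple random walk\<close>

text \<open>By the zero-one law it is enough that infinitely many of the events occur with positive
  probability. The decreasing unions of the tails have probability at least \<open>p\<close>, hence
  so does their intersection.\<close>

lemma (in prob_space) AE_infinitely_often:
  assumes F: "indep_events F UNIV" and "0 < p" "\<And>n. p \<le> prob (F n)"
  shows "AE w in M. \<exists>\<^sub>\<infinity>n. w \<in> F (n :: nat)"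
proof -
  have [measurable]: "F n \<in> events" for n using F by (auto simp: indep_events_def)
  have sp: "{w \<in> space M. w \<in> F m} = F m" for m using sets.sets_into_space[of "F m" M] by auto
  have "(AE w in M. infinite {m. w \<in> F m}) \<or> (AE w in M. finite {m. w \<in> F m})"
    by (rule borel_0_1_law_AE) (use F in \<open>simp add: sp\<close>)
  moreover have "\<not> (AE w in M. finite {m. w \<in> F m})"
  proof
    assume fin: "AE w in M. finite {m. w \<in> F m}"
    let ?U = "\<lambda>n. \<Union>m\<in>{n..}. F m"
    have "(\<lambda>n. prob (?U n)) \<longlonglongrightarrow> prob (\<Inter>n. ?U n)"
      by (rule finite_Lim_measure_decseq) (auto simp: decseq_def intro: order_trans)
    moreover have "p \<le> prob (?U n)" for n
    proof -
      have "p \<le> prob (F n)" by (rule assms(3))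
      also have "\<dots> \<le> prob (?U n)" by (rule finite_measure_mono) auto
      finally show ?thesis .
    qed
    ultimately have "p \<le> prob (\<Inter>n. ?U n)" by (intro LIMSEQ_le_const) auto
    moreover have "prob (\<Inter>n. ?U n) = 0"
    proof (rule prob_eq_0[THEN iffD2])
      show "AE w in M. w \<notin> (\<Inter>n. ?U n)"
        using fin by eventually_elim (auto simp: finite_nat_iff_bounded Ball_def subset_eq, metis linorder_not_less)
    qed simp
    ultimately show False using assms(2) by simp
  qed
  ultimately show ?thesis by (simp add: frequently_cofinite)
qed

section \<open>Law and escape of the simple random walk\<close>

lemma finite_unit_steps [simp]: "finite unit_steps"
  and unit_steps_nonempty [simp]: "unit_steps \<noteq> {}"
  by (auto simp: unit_steps_def)

lemma set_pmf_unit_steps [simp]: "set_pmf (pmf_of_set unit_steps) = unit_steps"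
  by (rule set_pmf_of_set) auto

lemma rvec_axis: "rvec (axis k c) = axis k (real_of_int c)"
  by (simp add: rvec_def vec_eq_iff axis_def)

lemma norm_axis: "norm (axis k c :: real ^ 'd) = \<bar>c\<bar>"
  by (simp add: norm_eq_sqrt_inner inner_axis_axis)

lemma norm_unit_step: "v \<in> unit_steps \<Longrightarrow> norm (rvec v) = 1"
  by (auto simp: unit_steps_def rvec_axis norm_axis)

definition step_space :: "(nat \<Rightarrow> int ^ 'd::finite) measure" where
  "step_space = (\<Pi>\<^sub>M t\<in>UNIV. measure_pmf (pmf_of_set unit_steps))"

definition partial_sums :: "(nat \<Rightarrow> 'a::comm_monoid_add) \<Rightarrow> nat \<Rightarrow> 'a" where
  "partial_sums \<xi> t = (\<Sum>k<t. \<xi> k)"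

interpretation steps: product_prob_space "\<lambda>_. measure_pmf (pmf_of_set unit_steps)" UNIV
  by unfold_locales

interpretation step_space: prob_space step_space
  unfolding step_space_def by (rule steps.P.prob_space_axioms)

lemma space_step_space [simp]: "space step_space = UNIV"
  by (simp add: step_space_def space_PiM PiE_UNIV_domain)

lemma coordinate_meas [measurable]: "(\<lambda>\<xi>. \<xi> t) \<in> measurable step_space (count_space UNIV)"
proof -
  have "(\<lambda>\<xi>. \<xi> t) \<in> measurable step_space (measure_pmf (pmf_of_set unit_steps))"
    unfolding step_space_def by (rule measurable_component_singleton) simp
  then show ?thesis by simp
qed

lemma measure_cylinder:
  assumes "finite J"
  shows "measure step_space {\<xi>. \<forall>k\<in>J. \<xi> k = v k} = (\<Prod>k\<in>J. pmf (pmf_of_set unit_steps) (v k))"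
proof -
  have "{\<xi>. \<forall>k\<in>J. \<xi> k = v k} = prod_emb UNIV (\<lambda>_. measure_pmf (pmf_of_set unit_steps)) J (Pi\<^sub>E J (\<lambda>k. {v k}))"
    by (auto simp: prod_emb_def PiE_UNIV_domain PiE_iff space_PiM)
  then show ?thesis
    unfolding step_space_def
    using steps.measure_PiM_emb[of J "\<lambda>k. {v k}"] assms by (simp add: measure_pmf_single)
qed

lemma partial_sums_meas [measurable]:
  "(\<lambda>\<xi>. partial_sums \<xi> t) \<in> measurable step_space (count_space UNIV)"
proof (induction t)
  case (Suc t)
  have "(\<lambda>\<xi>. v + \<xi> t) \<in> measurable step_space (count_space UNIV)" for v
    by (rule measurable_compose[OF coordinate_meas]) simp
  from measurable_compose_countable[OF this Suc] show ?case by (simp add: partial_sums_def)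
qed (simp add: partial_sums_def)

lemma trajectory_coordinate [measurable]:
  "(\<lambda>S. S t) \<in> measurable trajectory_space (count_space UNIV)"
  unfolding trajectory_space_def by (rule measurable_component_singleton) simp

lemma partial_sums_trajectory [measurable]: "partial_sums \<in> measurable step_space trajectory_space"
  unfolding trajectory_space_def
  by (rule measurable_PiM_single') (simp_all add: PiE_UNIV_domain partial_sums_meas)

lemma srw_law_eq: "srw_law = distr step_space trajectory_space partial_sums"
  by (simp add: srw_law_def step_space_def partial_sums_def[abs_def])

lemma space_trajectory_space [simp]: "space trajectory_space = UNIV"
  by (simp add: trajectory_space_def space_PiM PiE_UNIV_domain)

lemma pred_follows_trajectory [measurable]: "Measurable.pred trajectory_space (\<lambda>S. follows S p)"
  by (induction p) simp_all

text \<open>Following \<open>p\<close> prescribes the first \<open>length p\<close> steps, in the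
  reverse order of the list; this is a cylinder, and its probability is a product.\<close>

lemma measure_srw_follows: "measure srw_law {S. follows S p} = step_weight p"
proof -
  have fol: "follows (partial_sums \<xi>) p \<longleftrightarrow> (\<forall>k\<in>{..<length p}. \<xi> k = rev p ! k)" for \<xi>
  proof (induction p)
    case (Cons v p)
    have "partial_sums \<xi> (Suc (length p)) = v + sum_list p \<longleftrightarrow> \<xi> (length p) = v"
      if "follows (partial_sums \<xi>) p"
      using follows_end[OF that] by (simp add: partial_sums_def add.commute)
    moreover have "(\<forall>k\<in>{..<length (v # p)}. \<xi> k = rev (v # p) ! k) \<longleftrightarrow>
        (\<forall>k\<in>{..<length p}. \<xi> k = rev p ! k) \<and> \<xi> (length p) = v"
      by (auto simp: nth_append less_Suc_eq)
    ultimately show ?case using Cons by auto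
  qed (simp add: partial_sums_def)
  have [measurable]: "{S. follows S p} \<in> sets trajectory_space"
    using pred_follows_trajectory by (simp add: pred_def)
  have "measure srw_law {S. follows S p} = measure step_space (partial_sums -` {S. follows S p} \<inter> space step_space)"
    unfolding srw_law_eq by (rule measure_distr) simp_all
  also have "\<dots> = measure step_space {\<xi>. \<forall>k\<in>{..<length p}. \<xi> k = rev p ! k}"
    by (simp add: vimage_def fol)
  also have "\<dots> = (\<Prod>k<length p. pmf (pmf_of_set unit_steps) (rev p ! k))"
    by (rule measure_cylinder) simp
  also have "\<dots> = step_weight p"
  proof (induction p)
    case (Cons v p)
    then show ?case by (simp add: step_weight_def nth_append)
  qed (simp add: step_weight_def)
  finally show ?thesis .
qed

text \<open>Almost surely the walk makes arbitrarily long runs of equal steps, so it leaves every ball.\<close>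

lemma AE_srw_escaping: "AE S in srw_law :: (nat \<Rightarrow> int ^ 'd::finite) measure. escaping S"
proof -
  let ?P = "step_space :: (nat \<Rightarrow> int ^ 'd) measure"
  define e :: "int ^ 'd" where "e = axis undefined 1"
  define q where "q = pmf (pmf_of_set unit_steps) e"
  have e: "e \<in> unit_steps" by (auto simp: unit_steps_def e_def)
  have q: "0 < q" unfolding q_def by (rule pmf_positive) (use e in simp)
  have unit: "AE \<xi> in ?P. \<xi> t \<in> unit_steps" for t
  proof -
    have "AE v in measure_pmf (pmf_of_set (unit_steps :: (int ^ 'd) set)). v \<in> unit_steps"
      by (simp add: AE_measure_pmf_iff)
    then show ?thesis
      unfolding step_space_def by (intro AE_PiM_component) (auto intro: prob_space_measure_pmf)
  qed
  have far: "AE \<xi> in ?P. \<exists>t. real n < norm (rvec (partial_sums \<xi> t))" for n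
  proof -
    \<comment> \<open>A run of \<open>m\<close> equal steps displaces the walk by m > 2n, so one end
      of the run is at distance more than \<open>n\<close>. The blocks \<open>K b\<close> of length
      \<open>m\<close> are disjoint, which makes the runs \<open>F b\<close> independent, each of
      probability \<open>q ^ m\<close>.\<close>
    define m where "m = 2 * n + 2"
    define K where "K b = {b * m..<b * m + m}" for b
    define F where "F b = {\<xi>. \<forall>k\<in>K b. \<xi> k = e}" for b
    have F_meas: "F b \<in> sets ?P" for b
    proof -
      have "Measurable.pred ?P (\<lambda>\<xi>. \<forall>k\<in>K b. \<xi> k = e)" unfolding K_def by measurable
      then show ?thesis by (simp add: pred_def F_def)
    qed
    have disj: "disjoint_family K"
      unfolding disjoint_family_on_def
    proof (intro ballI impI)
      have "k div m = b" if "k \<in> K b" for k b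
        using that by (intro div_nat_eqI) (auto simp: K_def mult.commute)
      then show "K b \<inter> K c = {}" if "b \<noteq> c" for b c using that by auto
    qed
    have pF: "measure ?P (\<Inter>b\<in>J. F b) = (\<Prod>b\<in>J. q ^ m)" if "finite J" for J
    proof -
      have "(\<Inter>b\<in>J. F b) = {\<xi>. \<forall>k\<in>\<Union>b\<in>J. K b. \<xi> k = e}" by (auto simp: F_def)
      then have "measure ?P (\<Inter>b\<in>J. F b) = (\<Prod>k\<in>(\<Union>b\<in>J. K b). q)"
        using measure_cylinder[of "\<Union>b\<in>J. K b" "\<lambda>_. e"] that by (simp add: K_def q_def)
      also have "\<dots> = (\<Prod>b\<in>J. \<Prod>k\<in>K b. q)"
        by (rule prod.UNION_disjoint)
          (use that disj in \<open>auto simp: disjoint_family_on_def K_def[of]\<close>)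
      finally show ?thesis by (simp add: K_def)
    qed
    have pF1: "measure ?P (F b) = q ^ m" for b using pF[of "{b}"] by simp
    have "step_space.indep_events F UNIV"
      by (rule step_space.indep_eventsI) (use F_meas pF pF1 in auto)
    then have "AE \<xi> in ?P. \<exists>\<^sub>\<infinity>b. \<xi> \<in> F b"
      by (rule step_space.AE_infinitely_often[where p = "q ^ m"]) (use q pF1 in auto)
    then show ?thesis
    proof eventually_elim
      case (elim \<xi>)
      then obtain b where b: "\<xi> \<in> F b" using INFM_EX by blast
      have "partial_sums \<xi> (b * m + m) = partial_sums \<xi> (b * m) + (\<Sum>k\<in>K b. \<xi> k)"
        unfolding partial_sums_def K_def lessThan_atLeast0
        by (rule sum.atLeastLessThan_concat[symmetric]) auto
      also have "(\<Sum>k\<in>K b. \<xi> k) = (\<Sum>k\<in>K b. e)" using b by (auto simp: F_def)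
      also have "\<dots> = axis undefined (int m)"
        by (simp add: K_def e_def vec_eq_iff axis_def of_nat_index)
      finally have "rvec (partial_sums \<xi> (b * m + m)) - rvec (partial_sums \<xi> (b * m)) = axis undefined (real m)"
        by (simp add: rvec_diff[symmetric] rvec_axis)
      then have "real m \<le> norm (rvec (partial_sums \<xi> (b * m + m))) + norm (rvec (partial_sums \<xi> (b * m)))"
        using norm_triangle_ineq4[of "rvec (partial_sums \<xi> (b * m + m))" "rvec (partial_sums \<xi> (b * m))"]
        by (simp add: norm_axis)
      then have "real n < norm (rvec (partial_sums \<xi> (b * m + m))) \<or> real n < norm (rvec (partial_sums \<xi> (b * m)))"
        by (auto simp: m_def)
      then show ?case by blast
    qed
  qed
  have "AE \<xi> in ?P. (\<forall>t. \<xi> t \<in> unit_steps) \<and> (\<forall>n. \<exists>t. real n < norm (rvec (partial_sums \<xi> t)))"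
    using unit far by (simp add: AE_all_countable)
  then have "AE \<xi> in ?P. escaping (partial_sums \<xi>)"
  proof eventually_elim
    case (elim \<xi>)
    have "norm (rvec (partial_sums \<xi> (Suc t)) - rvec (partial_sums \<xi> t)) = 1" for t
      using elim norm_unit_step[of "\<xi> t"] by (simp add: rvec_diff[symmetric] partial_sums_def)
    then show ?case using elim by (simp add: escaping_def) (simp add: partial_sums_def)
  qed
  moreover have "{S \<in> space trajectory_space. escaping S} \<in> sets (trajectory_space :: (nat \<Rightarrow> int ^ 'd) measure)"
  proof -
    have "(\<lambda>S. norm (rvec (S (Suc t)) - rvec (S t))) \<in> borel_measurable (trajectory_space :: (nat \<Rightarrow> int ^ 'd) measure)" for t
    proof -
      have "(\<lambda>S. norm (rvec v - rvec (S t))) \<in> borel_measurable (trajectory_space :: (nat \<Rightarrow> int ^ 'd) measure)" for v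
        by (rule measurable_compose[OF trajectory_coordinate]) simp
      then show ?thesis by (rule measurable_compose_countable) (rule trajectory_coordinate)
    qed
    note [measurable] = this
    have [measurable]: "(\<lambda>S. norm (rvec (S t))) \<in> borel_measurable (trajectory_space :: (nat \<Rightarrow> int ^ 'd) measure)" for t
      by (rule measurable_compose[OF trajectory_coordinate]) simp
    show ?thesis unfolding escaping_def by measurable
  qed
  ultimately show ?thesis
    unfolding srw_law_eq by (subst AE_distr_iff) (auto simp: partial_sums_trajectory)
qed

section \<open>Measurability\<close>

lemma hitting_time_alt:
  "hitting_time L S = (if \<exists>t. S t \<in> L then enat (LEAST t. S t \<in> L) else \<infinity>)"
proof (cases "\<exists>t. S t \<in> L")
  case True
  have "hitting_time L S = enat (LEAST t. S t \<in> L)"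
    unfolding hitting_time_eq_enat
    using LeastI_ex[OF True] not_less_Least[of _ "\<lambda>t. S t \<in> L"] by blast
  then show ?thesis using True by simp
next
  case False
  then show ?thesis by (auto simp: hitting_time_def top_enat_def)
qed

lemma hitting_time_meas:
  assumes [measurable]: "\<And>t. Measurable.pred M (\<lambda>w. S w t \<in> L)"
  shows "(\<lambda>w. hitting_time L (S w)) \<in> measurable M (count_space UNIV)"
  unfolding hitting_time_alt by measurable

text \<open>Clusters are regarded as elements of the countable set of finite subsets. Conditioning
  on the value of the cluster is then a countable decomposition, which the type of all subsets would
  not allow.\<close>

lemma cluster_step_meas:
  fixes S :: "'w \<Rightarrow> nat \<Rightarrow> 's::countable"
  assumes A: "A \<in> measurable M (count_space {B. finite B})"
    and S: "\<And>t. (\<lambda>w. S w t) \<in> measurable M (count_space UNIV)"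
    and \<tau>: "\<And>B. finite B \<Longrightarrow> (\<lambda>w. \<tau> w B) \<in> measurable M (count_space UNIV)"
  shows "(\<lambda>w. A w \<union> site_at (S w) (\<tau> w (A w))) \<in> measurable M (count_space {B. finite B})"
proof -
  have fin: "finite (site_at T t)" for T :: "nat \<Rightarrow> 's" and t
    by (cases t) (auto simp: site_at_def)
  have "(\<lambda>w. B \<union> site_at (S w) t) \<in> measurable M (count_space {B. finite B})" if "finite B" for B t
  proof (cases t)
    case (enat n)
    have "(\<lambda>w. B \<union> {S w n}) \<in> measurable M (count_space {B. finite B})"
      by (rule measurable_compose[OF S]) (use that in auto)
    then show ?thesis using enat by (simp add: site_at_def)
  qed (use that in \<open>auto simp: site_at_def\<close>)
  then have "(\<lambda>w. B \<union> site_at (S w) (\<tau> w B)) \<in> measurable M (count_space {B. finite B})" if "finite B" for B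
    by (rule measurable_compose_countable[OF _ \<tau>[OF that]]) (use that in auto)
  then show ?thesis
    by (intro measurable_compose_countable'[where g = A and I = "{B. finite B}" and
          f = "\<lambda>B w. B \<union> site_at (S w) (\<tau> w B)"] A countable_Collect_finite) auto
qed

lemma measurable_count_space_subset:
  "f \<in> measurable M (count_space I) \<Longrightarrow> f \<in> measurable M (count_space UNIV)"
  by (rule measurable_compose[of f M "count_space I" "\<lambda>x. x"]) auto

lemma idla_cluster_meas:
  fixes W :: "'w \<Rightarrow> nat \<Rightarrow> nat \<Rightarrow> int ^ 'd::finite"
  assumes W: "\<And>i t. i \<in> {1..N} \<Longrightarrow> (\<lambda>w. W w i t) \<in> measurable M (count_space UNIV)" and "n \<le> N"
  shows "(\<lambda>w. idla_cluster (W w) n) \<in> measurable M (count_space {B. finite B})"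
  using assms(2)
proof (induction n)
  case (Suc n)
  note [measurable] = W[of "Suc n"]
  have "(\<lambda>w. idla_cluster (W w) n \<union> site_at (W w (Suc n))
      ((\<lambda>B. hitting_time (- B) (W w (Suc n))) (idla_cluster (W w) n)))
      \<in> measurable M (count_space {B. finite B})"
  proof (rule cluster_step_meas)
    show "(\<lambda>w. hitting_time (- B) (W w (Suc n))) \<in> measurable M (count_space UNIV)" for B
      by (rule hitting_time_meas, rule measurable_compose[OF W]) (use Suc.prems in auto)
  qed (use Suc W in auto)
  then show ?case by simp
qed simp

context scheduled_walks
begin

lemma history_meas:
  "(\<lambda>w. history (\<lambda>i. W i w) (c w) n) \<in> measurable M (count_space UNIV)"
proof (induction n)
  case (Suc n)
  have step: "(\<lambda>w. (W a w (Suc t) - W a w t) # vs) \<in> measurable M (count_space UNIV)"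
    if "a \<in> {1..N}" for a t vs
  proof -
    have "(\<lambda>w. (x - W a w t) # vs) \<in> measurable M (count_space UNIV)" for x
      by (rule measurable_compose[OF W_meas[OF that]]) simp
    then show ?thesis by (rule measurable_compose_countable[OF _ W_meas[OF that]])
  qed
  define g where "g us vs w = (W (c w us) w (Suc (length (steps_of (c w us) us))) -
      W (c w us) w (length (steps_of (c w us) us))) # vs" for us vs w
  have "g us vs \<in> measurable M (count_space UNIV)" for us vs
  proof -
    \<comment> \<open>Measurability is assumed only for walks with index in \<open>{1..N}\<close>,
      so the choice of the rule is treated as an element of that set.\<close>
    have "(\<lambda>w. c w us) \<in> measurable M (count_space {1..N})"
      using measurable_G[OF c_meas[of us]] c_range by (auto simp: measurable_count_space_eq2_countable)
    then show ?thesis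
      unfolding g_def
      by (intro measurable_compose_countable'[where I = "{1..N}" and g = "\<lambda>w. c w us" and
            f = "\<lambda>a w. (W a w (Suc (length (steps_of a us))) - W a w (length (steps_of a us))) # vs"] step) auto
  qed
  then have "(\<lambda>w. g (schedule (c w) vs) vs w) \<in> measurable M (count_space UNIV)" for vs
    by (rule measurable_compose_countable[where f = "\<lambda>us. g us vs"]) (rule measurable_G[OF schedule_meas])
  then have "(\<lambda>w. g (schedule (c w) (history (\<lambda>i. W i w) (c w) n)) (history (\<lambda>i. W i w) (c w) n) w)
      \<in> measurable M (count_space UNIV)"
    by (rule measurable_compose_countable[where f = "\<lambda>vs w. g (schedule (c w) vs) vs w"]) (rule Suc)
  moreover have "history (\<lambda>i. W i w) (c w) (Suc n) =
      g (schedule (c w) (history (\<lambda>i. W i w) (c w) n)) (history (\<lambda>i. W i w) (c w) n) w" for w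
    by (simp add: g_def Let_def)
  ultimately show ?case by (simp only:)
qed simp

definition final_history :: "'w \<Rightarrow> (int ^ 'd) list" where
  "final_history w = history (\<lambda>i. W i w) (c w) (completion_step N (\<lambda>i. W i w) (c w))"

lemma final_history_meas: "final_history \<in> measurable M (count_space UNIV)"
proof -
  have [measurable]: "Measurable.pred M (\<lambda>w. card (occupied (history (\<lambda>i. W i w) (c w) n)) = N)" for n
    by (rule measurable_compose[OF history_meas]) simp
  have "(\<lambda>w. completion_step N (\<lambda>i. W i w) (c w)) \<in> measurable M (count_space UNIV)"
    unfolding completion_step_def by measurable
  then show ?thesis
    unfolding final_history_def by (rule measurable_compose_countable[OF history_meas])
qed

lemma obeys_history:
  assumes "\<And>i. i \<in> {1..N} \<Longrightarrow> W i w 0 = 0"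
  shows "obeys w (history (\<lambda>i. W i w) (c w) n)"
  unfolding obeys_def
proof
  fix i assume i: "i \<in> {1..N}"
  show "follows (W i w) (steps_of i (schedule (c w) (history (\<lambda>i. W i w) (c w) n)))"
    by (rule follows_history[where c = "c w" and I = "{1..N}" and W = "\<lambda>i. W i w"])
      (rule c_range, rule assms, assumption, rule i)
qed

lemma finishes_final_history:
  assumes "finishes w vs" shows "final_history w = vs"
proof -
  have "history (\<lambda>i. W i w) (c w) (length vs) = vs"
    by (rule history_eqI[where c = "c w" and I = "{1..N}" and W = "\<lambda>i. W i w"])
      (use assms c_range in \<open>auto simp: finishes_def obeys_def\<close>)
  then show ?thesis
    unfolding final_history_def using assms completion_step_eq by (metis finishes_def)
qed

end

interpretation srw: prob_space srw_law
  unfolding srw_law_eq by (rule step_space.prob_space_distr) simp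

lemma sets_srw_law [simp]: "sets srw_law = sets trajectory_space"
  and space_srw_law [simp]: "space srw_law = UNIV"
  by (simp_all add: srw_law_eq)

lemma follows_sets: "{S. follows S p} \<in> sets trajectory_space"
  using pred_follows_trajectory by (simp add: pred_def)

text \<open>Ordinary internal DLA is the scheduled system with rule \<open>one_by_one\<close> and no
  extra randomness, so \<open>G\<close> is the trivial sigma-algebra. Completion enters as the
  hypothesis that the weights sum to 1, the form in which the coupling supplies it.\<close>

lemma emeasure_idla_law:
  fixes D :: "(int ^ 'd::finite) set set"
  assumes "0 < N"
    and "(\<integral>\<^sup>+ vs. ennreal (step_weight vs) \<partial>count_space {vs :: (int ^ 'd) list. completes N vs}) = 1"
  shows "emeasure (idla_law N) D =
     (\<integral>\<^sup>+ vs. ennreal (step_weight vs) \<partial>count_space {vs. completes N vs \<and> occupied vs \<in> D})"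
proof -
  let ?M = "\<Pi>\<^sub>M i\<in>{1..N}. srw_law :: (nat \<Rightarrow> int ^ 'd) measure"
  interpret P: product_prob_space "\<lambda>_. srw_law :: (nat \<Rightarrow> int ^ 'd) measure" "{1..N}"
    by unfold_locales
  have W: "(\<lambda>w. w i t) \<in> measurable ?M (count_space UNIV)" if "i \<in> {1..N}" for i t
  proof (rule measurable_compose[of "\<lambda>w. w i" _ trajectory_space])
    have "(\<lambda>w. w i) \<in> measurable ?M srw_law" by (rule measurable_component_singleton[OF that])
    then show "(\<lambda>w. w i) \<in> measurable ?M trajectory_space"
      unfolding measurable_cong_sets[OF refl sets_srw_law] .
  qed (rule trajectory_coordinate)
  interpret scheduled_walks ?M N "\<lambda>i w. w i" "sigma (space ?M) {}" "\<lambda>_. one_by_one N"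
  proof
    fix C p assume "C \<in> sets (sigma (space ?M) {})"
    then have C: "C = {} \<or> C = space ?M" by (simp add: sigma_sets_empty_eq)
    have "{w \<in> space ?M. \<forall>i\<in>{1..N}. follows (w i) (p i)} =
        prod_emb {1..N} (\<lambda>_. srw_law) {1..N} (\<Pi>\<^sub>E i\<in>{1..N}. {S. follows S (p i)})"
      by (auto simp: prod_emb_def space_PiM PiE_iff extensional_def)
    then have "measure ?M {w \<in> space ?M. \<forall>i\<in>{1..N}. follows (w i) (p i)} = (\<Prod>i\<in>{1..N}. step_weight (p i))"
      using P.measure_PiM_emb[of "{1..N}" "\<lambda>i. {S. follows S (p i)}"]
      by (simp add: follows_sets measure_srw_follows)
    then show "measure ?M (C \<inter> {w \<in> space ?M. \<forall>i\<in>{1..N}. follows (w i) (p i)}) =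
        measure ?M C * (\<Prod>i\<in>{1..N}. step_weight (p i))"
      using C P.P.prob_space by (auto simp: Int_absorb1)
  qed (use W assms(1) in \<open>auto simp: one_by_one_def sigma_sets_empty_eq\<close>)
  show ?thesis
    unfolding idla_law_def
  proof (rule emeasure_cluster)
    show "AE w in ?M. \<exists>vs. finishes w vs" unfolding AE_finishes_iff by (rule assms(2))
    show "(\<lambda>W. idla_cluster W N) \<in> measurable ?M (count_space UNIV)"
      by (rule measurable_count_space_subset, rule idla_cluster_meas[OF W]) auto
    show "idla_cluster w N = occupied vs" if "finishes w vs" for w vs
      using that assms(1) unfolding finishes_def obeys_def
      by (intro idla_cluster_one_by_one) auto
  qed
qed

section \<open>The coupling for given explorers\<close>

text \<open>Used to separate the collection of all coins from the individual walks, and the shells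
  of one explorer from one another.\<close>

lemma flashing_explorers_indep_groups:
  assumes fe: "flashing_explorers M h N S X Y R"
    and K: "(\<Union>k\<in>K. I k) \<subseteq> {s. explorer s \<in> {1..N}}" "disjoint_family_on I K"
  shows "prob_space.indep_sets M (\<lambda>k. sigma_sets (space M) (\<Union>s\<in>I k. source_algebra M S X Y R s)) K"
proof -
  interpret prob_space M using fe by (simp add: flashing_explorers_def)
  have "indep_sets (source_algebra M S X Y R) (\<Union>k\<in>K. I k)"
    using fe K(1) indep_sets_mono_index by (auto simp: flashing_explorers_def)
  moreover have "Int_stable (source_algebra M S X Y R s)" for s
    by (cases s) (auto simp: source_algebra_def generated_def sets.Int_stable)
  ultimately show ?thesis using K(2) by (rule indep_sets_collect_sigma)
qed

text \<open>The density is the derivative of \<open>(r / H) ^ d\<close>, the distribution function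
  of the distance to the centre of a uniform point in a d-dimensional ball of radius
  \<open>H\<close>. The case a = H gives total mass 1, the case a = H / 4 the probability of a small
  radius.\<close>

lemma nn_integral_radius_density:
  assumes "0 < d" "0 < H" "0 \<le> a" "a \<le> H"
  shows "(\<integral>\<^sup>+ r. ennreal (real d * r ^ (d - 1) / H ^ d * indicator {0..H} r) * indicator {..a} r \<partial>lborel) =
     ennreal ((a / H) ^ d)"
proof -
  have "(\<integral>\<^sup>+ r. ennreal (real d * r ^ (d - 1) / H ^ d * indicator {0..H} r) * indicator {..a} r \<partial>lborel) =
      (\<integral>\<^sup>+ r. ennreal (real d * r ^ (d - 1) / H ^ d) * indicator {0..a} r \<partial>lborel)"
    by (rule nn_integral_cong) (use assms in \<open>auto simp: indicator_def\<close>)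
  also have "\<dots> = ennreal (a ^ d / H ^ d - 0 ^ d / H ^ d)"
  proof (rule nn_integral_FTC_Icc)
    show "((\<lambda>r. r ^ d / H ^ d) has_real_derivative real d * r ^ (d - 1) / H ^ d) (at r)" for r
      using assms(2) by (auto intro!: derivative_eq_intros)
  qed (use assms in auto)
  finally show ?thesis using assms by (simp add: power_divide zero_power)
qed

lemma measurable_generated:
  assumes "f \<in> space M \<rightarrow> space B" "generated M f B \<subseteq> sets G" "space G = space M"
  shows "f \<in> measurable G B"
proof -
  have "f \<in> measurable (vimage_algebra (space M) f B) B"
    using assms(1) by (rule measurable_vimage_algebra1)
  then show ?thesis using assms(2,3) by (auto simp: measurable_def generated_def)
qed

locale flashing_process =
  fixes M :: "'w measure" and h :: "nat \<Rightarrow> nat" and N :: nat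
    and S :: "nat \<Rightarrow> 'w \<Rightarrow> nat \<Rightarrow> int ^ 'd::finite" and X Y :: "nat \<Rightarrow> 'w \<Rightarrow> nat \<Rightarrow> bool"
    and R :: "nat \<Rightarrow> 'w \<Rightarrow> nat \<Rightarrow> real"
  assumes explorers: "flashing_explorers M h N S X Y R"
    and N_pos: "0 < N" and h_pos: "\<And>j. h j > 0"
begin

sublocale prob_space M
  using explorers by (simp add: flashing_explorers_def)

definition revealed :: "source set \<Rightarrow> 'w measure" where
  "revealed I = sigma (space M) (\<Union>s\<in>I. source_algebra M S X Y R s)"

text \<open>This plays the role of \<open>G\<close> in the coupling: the rule may consult all coins
  and radii in advance, but a walk only through its revealed steps.\<close>

definition coin_space :: "'w measure" where
  "coin_space = revealed {s. explorer s \<in> {1..N} \<and> \<not> is_Walk s}"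

lemma source_algebra_events: "explorer s \<in> {1..N} \<Longrightarrow> source_algebra M S X Y R s \<subseteq> events"
  using explorers by (auto simp: flashing_explorers_def indep_sets_def)

lemma
  assumes "I \<subseteq> {s. explorer s \<in> {1..N}}"
  shows space_revealed: "space (revealed I) = space M"
    and sets_revealed: "sets (revealed I) = sigma_sets (space M) (\<Union>s\<in>I. source_algebra M S X Y R s)"
    and sets_revealed_subset: "sets (revealed I) \<subseteq> events"
proof -
  have sub: "(\<Union>s\<in>I. source_algebra M S X Y R s) \<subseteq> events"
    using assms source_algebra_events by blast
  then have "(\<Union>s\<in>I. source_algebra M S X Y R s) \<subseteq> Pow (space M)"
    using sets.space_closed[of M] by blast
  then show "space (revealed I) = space M"
    and sets: "sets (revealed I) = sigma_sets (space M) (\<Union>s\<in>I. source_algebra M S X Y R s)"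
    unfolding revealed_def by (simp_all only: space_measure_of sets_measure_of)
  show "sets (revealed I) \<subseteq> events"
    unfolding sets by (rule sets.sigma_sets_subset[OF sub])
qed

lemma revealed_meas:
  assumes I: "I \<subseteq> {s. explorer s \<in> {1..N}}"
  shows "Coin_X i j \<in> I \<Longrightarrow> Measurable.pred (revealed I) (\<lambda>w. X i w j)"
    and "Coin_Y i j \<in> I \<Longrightarrow> Measurable.pred (revealed I) (\<lambda>w. Y i w j)"
    and "Radius_R i j \<in> I \<Longrightarrow> (\<lambda>w. R i w j) \<in> borel_measurable (revealed I)"
proof -
  have sub: "source_algebra M S X Y R s \<subseteq> sets (revealed I)" if "s \<in> I" for s
    unfolding sets_revealed[OF I] using that by blast
  show "Coin_X i j \<in> I \<Longrightarrow> Measurable.pred (revealed I) (\<lambda>w. X i w j)"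
    "Coin_Y i j \<in> I \<Longrightarrow> Measurable.pred (revealed I) (\<lambda>w. Y i w j)"
    "Radius_R i j \<in> I \<Longrightarrow> (\<lambda>w. R i w j) \<in> borel_measurable (revealed I)"
    by (drule sub, rule measurable_generated[OF _ _ space_revealed[OF I]]; simp add: source_algebra_def)+
qed

lemma space_coin_space [simp]: "space coin_space = space M"
  and sets_coin_space_subset: "sets coin_space \<subseteq> events"
  unfolding coin_space_def by (rule space_revealed sets_revealed_subset, blast)+

lemma coin_meas:
  assumes "i \<in> {1..N}"
  shows "Measurable.pred coin_space (\<lambda>w. X i w j)" "Measurable.pred coin_space (\<lambda>w. Y i w j)"
    "(\<lambda>w. R i w j) \<in> borel_measurable coin_space"
  unfolding coin_space_def by (rule revealed_meas; use assms in auto)+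

lemma S_meas:
  assumes "i \<in> {1..N}"
  shows "S i \<in> measurable M trajectory_space" "(\<lambda>w. S i w t) \<in> measurable M (count_space UNIV)"
proof -
  show "S i \<in> measurable M trajectory_space"
    using explorers assms by (simp add: flashing_explorers_def)
  from measurable_compose[OF this trajectory_coordinate]
  show "(\<lambda>w. S i w t) \<in> measurable M (count_space UNIV)" .
qed

lemma coin_space_measurable: "f \<in> measurable coin_space K \<Longrightarrow> f \<in> measurable M K"
  using sets_coin_space_subset by (auto simp: measurable_def)

text \<open>The test uses \<open>path_walk p\<close> instead of the walk of explorer
  \<open>i\<close>. For given \<open>p\<close> it then depends on the coins alone, which is what
  makes the rule measurable for \<open>coin_space\<close>. The guard excludes indices about whose
  coins nothing is assumed.\<close>

definition path_flashes :: "'w \<Rightarrow> nat \<Rightarrow> (int ^ 'd) list \<Rightarrow> bool" where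
  "path_flashes w i p \<longleftrightarrow> i \<in> {1..N} \<and> flashes h (path_walk p) (X i w) (Y i w) (R i w) (length p)"

lemma path_flashes_meas [measurable]: "Measurable.pred coin_space (\<lambda>w. path_flashes w i p)"
proof (cases "i \<in> {1..N}")
  case True
  then have eq: "path_flashes w i p \<longleftrightarrow> flashes h (path_walk p) (X i w) (Y i w) (R i w) (length p)" for w
    unfolding path_flashes_def by blast
  show ?thesis
    unfolding eq
  proof (rule pred_flashes)
    show "(\<lambda>w. path_walk p t) \<in> measurable coin_space (count_space UNIV)" for t
      by (rule measurable_count_space_const)
  qed (rule coin_meas[OF True])+
next
  case False
  then have eq: "path_flashes w i p \<longleftrightarrow> False" for w unfolding path_flashes_def by blast
  show ?thesis unfolding eq by (rule measurable_count_space_const)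
qed

lemma yielding_meas:
  "(\<lambda>w. yielding N (path_flashes w) us) \<in> measurable coin_space (count_space UNIV)"
proof -
  have "Measurable.pred coin_space (\<lambda>w. movable (path_flashes w) us k a)" for k a
    unfolding movable_def by (intro pred_intros_logic pred_intros_finite path_flashes_meas
        measurable_count_space_const finite_atLeastAtMost)
  then have "(\<lambda>w. LEAST a. movable (path_flashes w) us (Suc (card (occupied (map snd us)))) a)
      \<in> measurable coin_space (count_space UNIV)"
    by (rule measurable_Least)
  then show ?thesis
    unfolding yielding_def Let_def by (rule measurable_compose) simp
qed

lemma prob_follows: "i \<in> {1..N} \<Longrightarrow> prob {w \<in> space M. follows (S i w) p} = step_weight p"
  using measure_srw_follows[of p] measure_distr[OF S_meas(1) follows_sets, of i p] explorers
  by (simp add: flashing_explorers_def vimage_def Int_def conj_commute)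

sublocale scheduled_walks M N S coin_space "\<lambda>w. yielding N (path_flashes w)"
proof
  fix C p assume C: "C \<in> sets coin_space"
  have C': "C \<in> sigma_sets (space M)
      (\<Union>s\<in>{s. explorer s \<in> {1..N} \<and> \<not> is_Walk s}. source_algebra M S X Y R s)"
    using C unfolding coin_space_def by (subst (asm) sets_revealed) blast+
  \<comment> \<open>Explorers are numbered from 1, which leaves index 0 for the group of all coins;
    index \<open>k > 0\<close> carries the walk of explorer \<open>k\<close>.\<close>
  define I where "I k = (if k = 0 then {s. explorer s \<in> {1..N} \<and> \<not> is_Walk s} else {Walk k})" for k :: nat
  define A where "A k = (if k = 0 then C else {w \<in> space M. follows (S k w) (p k)})" for k
  have "indep_sets (\<lambda>k. sigma_sets (space M) (\<Union>s\<in>I k. source_algebra M S X Y R s)) {0..N}"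
    by (rule flashing_explorers_indep_groups[OF explorers])
      (auto simp: I_def disjoint_family_on_def split: if_splits)
  moreover have "A k \<in> sigma_sets (space M) (\<Union>s\<in>I k. source_algebra M S X Y R s)" for k
  proof (cases "k = 0")
    case False
    have "S k -` {T. follows T (p k)} \<inter> space M \<in> generated M (S k) trajectory_space"
      unfolding generated_def by (rule in_vimage_algebra) (rule follows_sets)
    then show ?thesis
      using False by (intro sigma_sets.Basic)
        (simp add: A_def I_def source_algebra_def vimage_def Int_def conj_commute)
  qed (use C' in \<open>simp add: A_def I_def\<close>)
  ultimately have "prob (\<Inter>k\<in>{0..N}. A k) = (\<Prod>k\<in>{0..N}. prob (A k))"
    by (intro indep_setsD) auto
  moreover have "(\<Inter>k\<in>{0..N}. A k) = C \<inter> {w \<in> space M. \<forall>i\<in>{1..N}. follows (S i w) (p i)}"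
    using sets.sets_into_space[OF C] by (auto simp: A_def split: if_splits)
  moreover have "(\<Prod>k\<in>{0..N}. prob (A k)) = prob C * (\<Prod>i\<in>{1..N}. step_weight (p i))"
    by (simp add: prod.atLeast_Suc_atMost A_def prob_follows)
  ultimately show "prob (C \<inter> {w \<in> space M. \<forall>i\<in>{1..N}. follows (S i w) (p i)}) =
      prob C * (\<Prod>i\<in>{1..N}. step_weight (p i))" by simp
qed (use sets_coin_space_subset yielding_meas yielding_in[OF N_pos] S_meas(2) in auto)

lemma walk_law: "i \<in> {1..N} \<Longrightarrow> distr M trajectory_space (S i) = srw_law"
  using explorers by (simp add: flashing_explorers_def)

section \<open>Almost sure escape and infinitely many favourable shells\<close>

lemma AE_escaping: "i \<in> {1..N} \<Longrightarrow> AE w in M. escaping (S i w)"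
  by (rule AE_distrD[OF S_meas(1)]) (simp_all only: walk_law AE_srw_escaping)

lemma prob_R_le:
  assumes "i \<in> {1..N}"
  shows "prob {w \<in> space M. R i w j \<le> real (h j) / 4} = (1 / 4) ^ CARD('d)"
proof -
  have d: "distributed M lborel (\<lambda>w. R i w j)
      (\<lambda>r. ennreal (real CARD('d) * r ^ (CARD('d) - 1) / real (h j) ^ CARD('d) * indicator {0..real (h j)} r))"
    using explorers assms by (simp add: flashing_explorers_def)
  have "emeasure M ((\<lambda>w. R i w j) -` {..real (h j) / 4} \<inter> space M) =
      ennreal ((real (h j) / 4 / real (h j)) ^ CARD('d))"
    by (rule trans[OF distributed_emeasure[OF d] nn_integral_radius_density]) (use h_pos[of j] in auto)
  then show ?thesis
    using h_pos[of j] by (simp add: emeasure_eq_measure vimage_def Int_def conj_commute)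
qed

text \<open>Whether shell \<open>j\<close> is favourable involves only the variables of explorer
  \<open>i\<close> attached to \<open>j\<close>, so these events are independent in
  \<open>j\<close>; a uniform lower bound on their probabilities then suffices.\<close>

lemma AE_favourable:
  assumes i: "i \<in> {1..N}"
  shows "AE w in M. \<exists>\<^sub>\<infinity>j. favourable h (X i w) (Y i w) (R i w) j"
proof -
  define I where "I j = {Coin_X i j, Coin_Y i j, Radius_R i j}" for j
  define F where "F j = {w \<in> space M. favourable h (X i w) (Y i w) (R i w) j}" for j
  have I: "I j \<subseteq> {s. explorer s \<in> {1..N}}" for j using i by (auto simp: I_def)
  have indep: "indep_sets (\<lambda>j. sets (revealed (I j))) UNIV"
    unfolding sets_revealed[OF I] by (rule flashing_explorers_indep_groups[OF explorers])
      (use i in \<open>auto simp: I_def disjoint_family_on_def\<close>)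
  have F_I: "F j \<in> sets (revealed (I j))" for j
  proof -
    have [measurable]: "Measurable.pred (revealed (I j)) (\<lambda>w. X i w j)"
      "Measurable.pred (revealed (I j)) (\<lambda>w. Y i w j)" "(\<lambda>w. R i w j) \<in> borel_measurable (revealed (I j))"
      by (rule revealed_meas[OF I], simp add: I_def)+
    have "Measurable.pred (revealed (I j)) (\<lambda>w. favourable h (X i w) (Y i w) (R i w) j)"
      unfolding favourable_def by measurable
    then show ?thesis unfolding pred_def space_revealed[OF I] F_def .
  qed
  have "indep_events F UNIV"
    unfolding indep_events_def_alt by (rule indep_sets_mono_sets[OF indep]) (use F_I in auto)
  \<comment> \<open>For \<open>h j \<le> 4\<close> the coin \<open>X\<close> alone gives at least
    \<open>(1 / 4) ^ CARD('d)\<close>. Otherwise \<open>Y\<close> gives at least 1 / 2, with value 1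
    in shell 0, and the independent condition on the radius gives exactly
    \<open>(1 / 4) ^ CARD('d)\<close>.\<close>
  moreover have "(1 / 2) * (1 / 4) ^ CARD('d) \<le> prob (F j)" for j
  proof (cases "h j \<le> 4")
    case True
    have "prob (F j) = (1 / real (h j)) ^ CARD('d)"
      using explorers i True by (simp add: F_def favourable_def flashing_explorers_def power_one_over)
    moreover have "(1 / 4) ^ CARD('d) \<le> (1 / real (h j)) ^ CARD('d)"
      using True h_pos[of j] by (intro power_mono frac_le) auto
    moreover have "(0::real) \<le> (1 / 4) ^ CARD('d)" by simp
    ultimately show ?thesis by linarith
  next
    case False
    let ?Y = "{w \<in> space M. Y i w j}" and ?R = "{w \<in> space M. R i w j \<le> real (h j) / 4}"
    define A where "A s = (if is_Coin_Y s then ?Y else ?R)" for s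
    have "?Y = (\<lambda>w. Y i w j) -` {True} \<inter> space M" "?R = (\<lambda>w. R i w j) -` {..real (h j) / 4} \<inter> space M"
      by auto
    moreover have "(\<lambda>w. Y i w j) -` {True} \<inter> space M \<in> source_algebra M S X Y R (Coin_Y i j)"
      "(\<lambda>w. R i w j) -` {..real (h j) / 4} \<inter> space M \<in> source_algebra M S X Y R (Radius_R i j)"
      unfolding source_algebra_def generated_def by (auto intro!: in_vimage_algebra)
    ultimately have "?Y \<in> source_algebra M S X Y R (Coin_Y i j)" "?R \<in> source_algebra M S X Y R (Radius_R i j)"
      by simp_all
    then have "prob (\<Inter>s\<in>{Coin_Y i j, Radius_R i j}. A s) = (\<Prod>s\<in>{Coin_Y i j, Radius_R i j}. prob (A s))"
      using explorers i unfolding flashing_explorers_def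
      by (intro indep_setsD[of "source_algebra M S X Y R" "{s. explorer s \<in> {1..N}}"]) (auto simp: A_def)
    then have "prob (?Y \<inter> ?R) = prob ?Y * prob ?R" by (simp add: A_def Int_commute)
    moreover have "?Y \<inter> ?R = F j" using False by (auto simp: F_def favourable_def)
    moreover have "1 / 2 \<le> prob ?Y" using explorers i by (simp add: flashing_explorers_def)
    ultimately show ?thesis using prob_R_le[OF i, of j] by (simp add: mult_right_mono)
  qed
  ultimately have "AE w in M. \<exists>\<^sub>\<infinity>j. w \<in> F j"
    by (intro AE_infinitely_often[where p = "(1 / 2) * (1 / 4) ^ CARD('d)"]) auto
  then show ?thesis
    using AE_space by eventually_elim (auto simp: F_def)
qed

section \<open>The random times and clusters of the coupling\<close>

abbreviation cluster :: "'w \<Rightarrow> nat \<Rightarrow> (int ^ 'd) set" where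
  "cluster w n \<equiv> flashing_cluster h (\<lambda>i. S i w) (\<lambda>i. X i w) (\<lambda>i. Y i w) (\<lambda>i. R i w) n"

definition settling :: "nat \<Rightarrow> 'w \<Rightarrow> enat" where
  "settling i w = settling_time h (S i w) (X i w) (Y i w) (R i w) (cluster w (i - 1))"

lemma settling_time_meas:
  assumes i: "i \<in> {1..N}"
  shows "(\<lambda>w. settling_time h (S i w) (X i w) (Y i w) (R i w) B) \<in> measurable M (count_space UNIV)"
  unfolding settling_time_eq_hitting_time
proof (rule hitting_time_meas)
  fix t
  have [measurable]: "Measurable.pred M (\<lambda>w. flashes h (S i w) (X i w) (Y i w) (R i w) t)"
    by (rule pred_flashes) (rule S_meas[OF i] coin_meas[OF i, THEN coin_space_measurable])+
  have [measurable]: "Measurable.pred M (\<lambda>w. S i w t \<notin> B)"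
    by (rule measurable_compose[OF S_meas(2)[OF i]]) simp
  show "Measurable.pred M (\<lambda>w. (flashes h (S i w) (X i w) (Y i w) (R i w) t \<and> S i w t \<notin> B) \<in> {True})"
    unfolding singleton_iff eq_True by measurable
qed

lemma cluster_meas: "n \<le> N \<Longrightarrow> (\<lambda>w. cluster w n) \<in> measurable M (count_space {B. finite B})"
proof (induction n)
  case (Suc n)
  then have n: "Suc n \<in> {1..N}" by simp
  show ?case
    unfolding flashing_cluster.simps
    by (rule cluster_step_meas[where \<tau> = "\<lambda>w. settling_time h (S (Suc n) w) (X (Suc n) w) (Y (Suc n) w) (R (Suc n) w)"])
      (rule Suc.IH, use n in simp, rule S_meas(2)[OF n], rule settling_time_meas[OF n])
qed simp

lemma settling_meas:
  assumes "i \<in> {1..N}" shows "settling i \<in> measurable M (count_space UNIV)"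
proof -
  have "(\<lambda>w. cluster w (i - 1)) \<in> measurable M (count_space {B. finite B})"
    by (rule cluster_meas) (use assms in auto)
  then show ?thesis
    unfolding settling_def
    by (rule measurable_compose_countable'[where f = "\<lambda>B w. settling_time h (S i w) (X i w) (Y i w) (R i w) B",
          OF settling_time_meas[OF assms]]) (rule countable_Collect_finite)
qed

lemma finite_flashing_cluster: "finite (cluster w n)"
proof (induction n)
  case (Suc n)
  have "finite (site_at T t)" for T :: "nat \<Rightarrow> int ^ 'd" and t by (cases t) (auto simp: site_at_def)
  then show ?case using Suc by simp
qed simp

definition stop_time :: "nat \<Rightarrow> 'w \<Rightarrow> nat" where
  "stop_time i w = length (steps_of i (schedule (yielding N (path_flashes w)) (final_history w)))"

lemma stop_time_meas: "stop_time i \<in> measurable M (count_space UNIV)"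
proof -
  have "(\<lambda>w. schedule (yielding N (path_flashes w)) (final_history w)) \<in> measurable M (count_space UNIV)"
    by (rule measurable_compose_countable[where f = "\<lambda>vs w. schedule (yielding N (path_flashes w)) vs"])
      (rule measurable_G[OF schedule_meas], rule final_history_meas)
  then show ?thesis unfolding stop_time_def by (rule measurable_compose) simp
qed

lemma occupied_final_history_meas:
  "(\<lambda>w. occupied (final_history w)) \<in> measurable M (count_space UNIV)"
  by (rule measurable_compose[OF final_history_meas]) simp

text \<open>For a single sample point, \<open>yielding_coupling\<close> applies with the flashing
  clusters as \<open>B\<close> and the settling times as \<open>\<tau>\<close>. Chance enters only
  through the validity of the two hypotheses.\<close>

lemma coupling_pointwise:
  assumes esc: "\<And>i. i \<in> {1..N} \<Longrightarrow> escaping (S i w)"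
    and fav: "\<And>i. i \<in> {1..N} \<Longrightarrow> \<exists>\<^sub>\<infinity>j. favourable h (X i w) (Y i w) (R i w) j"
  shows "finishes w (final_history w)"
    and "\<And>i. i \<in> {1..N} \<Longrightarrow> enat (the_enat (settling i w)) = settling i w"
    and "\<And>i. i \<in> {1..N} \<Longrightarrow> stop_time i w \<le> the_enat (settling i w)"
    and "occupied (final_history w) = (\<Union>i\<in>{1..N}. {S i w (stop_time i w)})"
    and "cluster w N = (\<Union>i\<in>{1..N}. {S i w (the_enat (settling i w))})"
proof -
  let ?\<tau> = "\<lambda>i. the_enat (settling i w)"
  show \<tau>: "enat (?\<tau> i) = settling i w" if i: "i \<in> {1..N}" for i
  proof -
    have "\<exists>t. settling i w = enat t"
      unfolding settling_def
      by (rule settling_time_finite[OF h_pos esc[OF i] fav[OF i] finite_flashing_cluster])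
    then show ?thesis by auto
  qed
  have step: "cluster w i = insert (S i w (?\<tau> i)) (cluster w (i - 1))" if i: "i \<in> {1..N}" for i
  proof -
    obtain k where k: "i = Suc k" using i by (cases i) auto
    have "settling_time h (S i w) (X i w) (Y i w) (R i w) (cluster w k) = enat (?\<tau> i)"
      using \<tau>[OF i] by (simp add: settling_def k)
    then show ?thesis using k by (auto simp: site_at_def)
  qed
  have settle: "flashes h (S i w) (X i w) (Y i w) (R i w) (?\<tau> i) \<and> S i w (?\<tau> i) \<notin> cluster w (i - 1) \<and>
      (\<forall>t<?\<tau> i. flashes h (S i w) (X i w) (Y i w) (R i w) t \<longrightarrow> S i w t \<in> cluster w (i - 1))"
    if i: "i \<in> {1..N}" for i
    using \<tau>[OF i, symmetric] unfolding settling_def settling_time_eq_enat .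
  \<comment> \<open>A walk that follows \<open>p\<close> agrees with \<open>path_walk p\<close> up
    to time \<open>length p\<close>, and a flash at this time depends on nothing later.\<close>
  have test: "path_flashes w i p \<longleftrightarrow> flashes h (S i w) (X i w) (Y i w) (R i w) (length p)"
    if i: "i \<in> {1..N}" and p: "follows (S i w) p" for i p
  proof -
    have "flashes h (path_walk p) (X i w) (Y i w) (R i w) (length p) \<longleftrightarrow>
        flashes h (S i w) (X i w) (Y i w) (R i w) (length p)"
      by (rule flashes_cong) (rule follows_unique[OF follows_path_walk p])
    then show ?thesis using i unfolding path_flashes_def by blast
  qed
  have start: "S i w 0 = 0" if "i \<in> {1..N}" for i using esc[OF that] by (simp add: escaping_def)
  have s1: "flashes h (S i w) (X i w) (Y i w) (R i w) (?\<tau> i)"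
    and s2: "S i w (?\<tau> i) \<notin> cluster w (i - 1)" if "i \<in> {1..N}" for i
    using settle[OF that] by blast+
  have s3: "S i w t \<in> cluster w (i - 1)"
    if "i \<in> {1..N}" "t < ?\<tau> i" "flashes h (S i w) (X i w) (Y i w) (R i w) t" for i t
    using settle that by blast
  note coupling = yielding_coupling[where S = "\<lambda>i. S i w" and B = "cluster w" and \<tau> = ?\<tau> and N = N and
      f = "path_flashes w" and F = "\<lambda>i. flashes h (S i w) (X i w) (Y i w) (R i w)", folded final_history_def]
  have "completes N (final_history w)"
    by (rule coupling(1)) (rule N_pos start test s1 s2 s3 step; assumption)+
  moreover have "obeys w (final_history w)"
    unfolding final_history_def by (rule obeys_history[OF start])
  ultimately show "finishes w (final_history w)" by (simp add: finishes_def)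
  show "stop_time i w \<le> ?\<tau> i" if "i \<in> {1..N}" for i
    unfolding stop_time_def by (rule coupling(2)) (rule N_pos start test s1 s2 s3 step that; assumption)+
  show "occupied (final_history w) = (\<Union>i\<in>{1..N}. {S i w (stop_time i w)})"
    unfolding stop_time_def by (rule coupling(3)) (rule N_pos start test s1 s2 s3 step; assumption)+
  have "cluster w n = (\<Union>i\<in>{1..n}. {S i w (?\<tau> i)})" if "n \<le> N" for n
    using that
  proof (induction n)
    case (Suc n)
    then have "cluster w (Suc n) = insert (S (Suc n) w (?\<tau> (Suc n))) (cluster w n)"
      using step[of "Suc n"] by simp
    then show ?case using Suc by (simp add: atLeastAtMostSuc_conv del: flashing_cluster.simps)
  qed simp
  then show "cluster w N = (\<Union>i\<in>{1..N}. {S i w (?\<tau> i)})" by blast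
qed

lemma AE_coupling:
  "AE w in M. (\<forall>i\<in>{1..N}. escaping (S i w)) \<and>
     (\<forall>i\<in>{1..N}. \<exists>\<^sub>\<infinity>j. favourable h (X i w) (Y i w) (R i w) j)"
  by (rule AE_conjI; rule AE_finite_allI) (auto intro: AE_escaping AE_favourable)

text \<open>The pointwise coupling shows that the coupled process completes almost surely. Rewritten
  as total weight 1, this also covers the walks released one at a time, and both laws are the same
  sum of weights.\<close>

lemma distr_final_cluster:
  "distr M (count_space UNIV) (\<lambda>w. occupied (final_history w)) = idla_law N"
proof (rule measure_eqI)
  have fin: "AE w in M. \<exists>vs. finishes w vs"
    using AE_coupling by eventually_elim (blast intro: coupling_pointwise(1))
  fix D
  have "emeasure (idla_law N) D = (\<integral>\<^sup>+ vs. ennreal (step_weight vs)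
      \<partial>count_space {vs :: (int ^ 'd) list. completes N vs \<and> occupied vs \<in> D})"
    by (rule emeasure_idla_law[OF N_pos]) (use fin in \<open>simp add: AE_finishes_iff\<close>)
  moreover have "emeasure (distr M (count_space UNIV) (\<lambda>w. occupied (final_history w))) D =
      (\<integral>\<^sup>+ vs. ennreal (step_weight vs) \<partial>count_space {vs. completes N vs \<and> occupied vs \<in> D})"
    by (rule emeasure_cluster[OF fin occupied_final_history_meas]) (simp add: finishes_final_history)
  ultimately show "emeasure (distr M (count_space UNIV) (\<lambda>w. occupied (final_history w))) D =
      emeasure (idla_law N) D" by simp
qed (simp add: idla_law_def)

end

section \<open>Existence of flashing explorers\<close>

lemma distr_pair_snd:
  assumes "prob_space M" "prob_space N"
  shows "distr (M \<Otimes>\<^sub>M N) N snd = N"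
proof (rule measure_eqI)
  interpret M: prob_space M by fact
  interpret N: prob_space N by fact
  fix A assume "A \<in> sets (distr (M \<Otimes>\<^sub>M N) N snd)"
  then have A: "A \<in> sets N" by simp
  have "snd -` A \<inter> space (M \<Otimes>\<^sub>M N) = space M \<times> A"
    using sets.sets_into_space[OF A] by (auto simp: space_pair_measure)
  then show "emeasure (distr (M \<Otimes>\<^sub>M N) N snd) A = emeasure N A"
    using A by (simp add: emeasure_distr N.emeasure_pair_measure_Times M.emeasure_space_1)
qed simp

lemma measure_pair_Times:
  assumes "prob_space N" "A \<in> sets M" "B \<in> sets N"
  shows "measure (M \<Otimes>\<^sub>M N) (A \<times> B) = measure M A * measure N B"
proof -
  interpret N: prob_space N by fact
  show ?thesis
    using assms(2,3) by (simp add: measure_def N.emeasure_pair_measure_Times enn2real_mult)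
qed

lemma choice2:
  assumes "\<And>i j. \<exists>b\<in>Q j. p i j b"
  shows "\<exists>f. \<forall>i j. f i j \<in> Q j \<and> p i j (f i j)"
proof -
  have "\<forall>i j. \<exists>b. b \<in> Q j \<and> p i j b" using assms by blast
  then show ?thesis unfolding choice_iff .
qed

text \<open>The measure \<open>L\<close> with the same sets lets a law, such as
  \<open>srw_law\<close>, stand in for the space \<open>K\<close> that defines the
  sigma-algebra.\<close>

lemma generatedE:
  assumes "A \<in> generated M f K" "space K = UNIV" "sets K = sets L"
  shows "\<exists>B\<in>sets L. A = f -` B \<inter> space M"
  using assms sets_vimage_algebra2[of f "space M" K] by (auto simp: generated_def)

lemma space_in_generated: "space M \<in> generated M f K"
  unfolding generated_def using sets.top[of "vimage_algebra (space M) f K"] by simp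

lemma generated_subset: "f \<in> measurable M K \<Longrightarrow> generated M f K \<subseteq> sets M"
  unfolding generated_def by (subst sets_vimage_algebra2) (auto dest: measurable_space)

section \<open>The product space of walks and coins\<close>

definition radius_density :: "nat \<Rightarrow> nat \<Rightarrow> real \<Rightarrow> ennreal" where
  "radius_density d n r = ennreal (real d * r ^ (d - 1) / real n ^ d * indicator {0..real n} r)"

lemma radius_density_meas [measurable]: "radius_density d n \<in> borel_measurable borel"
  unfolding radius_density_def[abs_def] by measurable

lemma prob_space_radius_density:
  assumes "0 < d" "0 < n" shows "prob_space (density lborel (radius_density d n))"
proof
  have "emeasure (density lborel (radius_density d n)) (space (density lborel (radius_density d n))) =
      (\<integral>\<^sup>+ r. radius_density d n r \<partial>lborel)"
    by (simp add: emeasure_density)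
  also have "\<dots> = (\<integral>\<^sup>+ r. radius_density d n r * indicator {..real n} r \<partial>lborel)"
    by (rule nn_integral_cong) (auto simp: radius_density_def indicator_def)
  also have "\<dots> = 1"
    unfolding radius_density_def
    using nn_integral_radius_density[of d "real n" "real n"] assms by simp
  finally show "emeasure (density lborel (radius_density d n)) (space (density lborel (radius_density d n))) = 1" .
qed

definition coin_law :: "nat \<Rightarrow> (nat \<Rightarrow> nat) \<Rightarrow> nat \<Rightarrow> (bool \<times> bool \<times> real) measure" where
  "coin_law d h j = measure_pmf (bernoulli_pmf (1 / real (h j) ^ d)) \<Otimes>\<^sub>M
     (measure_pmf (bernoulli_pmf (if j = 0 then 1 else 1 / 2)) \<Otimes>\<^sub>M density lborel (radius_density d (h j)))"

definition explorer_law ::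
  "(nat \<Rightarrow> nat) \<Rightarrow> ((nat \<Rightarrow> int ^ 'd::finite) \<times> (nat \<Rightarrow> bool \<times> bool \<times> real)) measure" where
  "explorer_law h = srw_law \<Otimes>\<^sub>M (\<Pi>\<^sub>M j\<in>UNIV. coin_law CARD('d) h j)"

definition explorers_law ::
  "(nat \<Rightarrow> nat) \<Rightarrow> nat \<Rightarrow> (nat \<Rightarrow> (nat \<Rightarrow> int ^ 'd::finite) \<times> (nat \<Rightarrow> bool \<times> bool \<times> real)) measure" where
  "explorers_law h N = (\<Pi>\<^sub>M i\<in>{1..N}. explorer_law h)"

context
  fixes h :: "nat \<Rightarrow> nat" and N :: nat
    and E :: "((nat \<Rightarrow> int ^ 'd::finite) \<times> (nat \<Rightarrow> bool \<times> bool \<times> real)) measure"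
    and P :: "(nat \<Rightarrow> (nat \<Rightarrow> int ^ 'd) \<times> (nat \<Rightarrow> bool \<times> bool \<times> real)) measure"
    and S :: "nat \<Rightarrow> (nat \<Rightarrow> (nat \<Rightarrow> int ^ 'd) \<times> (nat \<Rightarrow> bool \<times> bool \<times> real)) \<Rightarrow> nat \<Rightarrow> int ^ 'd"
    and X Y :: "nat \<Rightarrow> (nat \<Rightarrow> (nat \<Rightarrow> int ^ 'd) \<times> (nat \<Rightarrow> bool \<times> bool \<times> real)) \<Rightarrow> nat \<Rightarrow> bool"
    and R :: "nat \<Rightarrow> (nat \<Rightarrow> (nat \<Rightarrow> int ^ 'd) \<times> (nat \<Rightarrow> bool \<times> bool \<times> real)) \<Rightarrow> nat \<Rightarrow> real"
    and lX lY :: "nat \<Rightarrow> bool measure" and lR :: "nat \<Rightarrow> real measure"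
  assumes h: "\<And>j. h j > 0"
  defines "E \<equiv> explorer_law h" and "P \<equiv> explorers_law h N"
    and "S \<equiv> \<lambda>i w. fst (w i)" and "X \<equiv> \<lambda>i w j. fst (snd (w i) j)"
    and "Y \<equiv> \<lambda>i w j. fst (snd (snd (w i) j))" and "R \<equiv> \<lambda>i w j. snd (snd (snd (w i) j))"
    and "lX \<equiv> \<lambda>j. measure_pmf (bernoulli_pmf (1 / real (h j) ^ CARD('d)))"
    and "lY \<equiv> \<lambda>j :: nat. measure_pmf (bernoulli_pmf (if j = 0 then 1 else 1 / 2))"
    and "lR \<equiv> \<lambda>j. density lborel (radius_density CARD('d) (h j))"
begin

lemma lR_prob: "prob_space (lR j)"
  unfolding lR_def by (rule prob_space_radius_density) (use h in auto)

lemma coin_law_eq: "coin_law CARD('d) h j = lX j \<Otimes>\<^sub>M (lY j \<Otimes>\<^sub>M lR j)"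
  by (simp add: coin_law_def lX_def lY_def lR_def)

lemma lX_prob: "prob_space (lX j)" and lY_prob: "prob_space (lY j)"
  by (simp_all add: lX_def lY_def prob_space_measure_pmf)

lemma coin_law_prob: "prob_space (coin_law CARD('d) h j)"
  unfolding coin_law_eq by (intro prob_space_pair lX_prob lY_prob lR_prob)

lemma coins_prob: "prob_space (\<Pi>\<^sub>M j\<in>UNIV. coin_law CARD('d) h j)"
  by (intro prob_space_PiM coin_law_prob)

lemma E_eq: "E = srw_law \<Otimes>\<^sub>M (\<Pi>\<^sub>M j\<in>UNIV. coin_law CARD('d) h j)"
  by (simp add: E_def explorer_law_def)

lemma P_eq: "P = (\<Pi>\<^sub>M i\<in>{1..N}. E)"
  by (simp add: P_def explorers_law_def E_def)

lemma E_prob: "prob_space E"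
  unfolding E_eq by (intro prob_space_pair coins_prob srw.prob_space_axioms)

lemma P_prob: "prob_space P"
  unfolding P_eq by (intro prob_space_PiM E_prob)

lemma component_meas: "i \<in> {1..N} \<Longrightarrow> (\<lambda>w. w i) \<in> measurable P E"
  unfolding P_eq by (rule measurable_component_singleton)

lemma component_distr: "i \<in> {1..N} \<Longrightarrow> distr P E (\<lambda>w. w i) = E"
  unfolding P_eq by (rule distr_PiM_component[OF E_prob])

lemma coins_meas: "(\<lambda>p. snd p j) \<in> measurable E (coin_law CARD('d) h j)"
  unfolding E_eq by (rule measurable_compose[OF measurable_snd measurable_component_singleton]) simp

lemma coins_distr: "distr E (coin_law CARD('d) h j) (\<lambda>p. snd p j) = coin_law CARD('d) h j"
proof -
  let ?C = "\<Pi>\<^sub>M j\<in>UNIV. coin_law CARD('d) h j"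
  have "distr E (coin_law CARD('d) h j) (\<lambda>p. snd p j) =
      distr (distr E ?C snd) (coin_law CARD('d) h j) (\<lambda>c. c j)"
    by (subst distr_distr) (simp_all add: E_eq comp_def)
  also have "distr E ?C snd = ?C"
    unfolding E_eq by (rule distr_pair_snd[OF srw.prob_space_axioms coins_prob])
  also have "distr ?C (coin_law CARD('d) h j) (\<lambda>c. c j) = coin_law CARD('d) h j"
    by (rule distr_PiM_component[OF coin_law_prob]) simp
  finally show ?thesis .
qed

lemma coin_distr_compose:
  assumes i: "i \<in> {1..N}" and f: "f \<in> measurable (coin_law CARD('d) h j) L"
  shows "(\<lambda>w. f (snd (w i) j)) \<in> measurable P L"
    and "distr P L (\<lambda>w. f (snd (w i) j)) = distr (coin_law CARD('d) h j) L f"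
proof -
  have m: "(\<lambda>p. f (snd p j)) \<in> measurable E L" by (rule measurable_compose[OF coins_meas f])
  show "(\<lambda>w. f (snd (w i) j)) \<in> measurable P L" by (rule measurable_compose[OF component_meas[OF i] m])
  have "distr P L (\<lambda>w. f (snd (w i) j)) = distr (distr P E (\<lambda>w. w i)) L (\<lambda>p. f (snd p j))"
    by (subst distr_distr[OF m component_meas[OF i]]) (simp add: comp_def)
  also have "\<dots> = distr (distr E (coin_law CARD('d) h j) (\<lambda>p. snd p j)) L f"
    unfolding component_distr[OF i] by (subst distr_distr[OF f coins_meas]) (simp add: comp_def)
  finally show "distr P L (\<lambda>w. f (snd (w i) j)) = distr (coin_law CARD('d) h j) L f"
    unfolding coins_distr .
qed

lemma S_meas_P: "i \<in> {1..N} \<Longrightarrow> S i \<in> measurable P srw_law"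
  and S_distr: "i \<in> {1..N} \<Longrightarrow> distr P srw_law (S i) = srw_law"
proof -
  assume i: "i \<in> {1..N}"
  have m: "fst \<in> measurable E srw_law" by (simp add: E_eq)
  show "S i \<in> measurable P srw_law" unfolding S_def by (rule measurable_compose[OF component_meas[OF i] m])
  have "distr P srw_law (S i) = distr (distr P E (\<lambda>w. w i)) srw_law fst"
    by (subst distr_distr[OF m component_meas[OF i]]) (simp add: comp_def S_def)
  also have "\<dots> = srw_law"
    unfolding component_distr[OF i] unfolding E_eq by (rule prob_space.distr_pair_fst[OF coins_prob])
  finally show "distr P srw_law (S i) = srw_law" .
qed

lemma X_meas: "i \<in> {1..N} \<Longrightarrow> (\<lambda>w. X i w j) \<in> measurable P (lX j)"
  and X_distr: "i \<in> {1..N} \<Longrightarrow> distr P (lX j) (\<lambda>w. X i w j) = lX j"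
  and Y_meas: "i \<in> {1..N} \<Longrightarrow> (\<lambda>w. Y i w j) \<in> measurable P (lY j)"
  and Y_distr: "i \<in> {1..N} \<Longrightarrow> distr P (lY j) (\<lambda>w. Y i w j) = lY j"
  and R_meas: "i \<in> {1..N} \<Longrightarrow> (\<lambda>w. R i w j) \<in> measurable P (lR j)"
  and R_distr: "i \<in> {1..N} \<Longrightarrow> distr P (lR j) (\<lambda>w. R i w j) = lR j"
proof -
  assume i: "i \<in> {1..N}"
  have yr: "prob_space (lY j \<Otimes>\<^sub>M lR j)" by (intro prob_space_pair lY_prob lR_prob)
  have m: "fst \<in> measurable (coin_law CARD('d) h j) (lX j)"
    "(\<lambda>c. fst (snd c)) \<in> measurable (coin_law CARD('d) h j) (lY j)"
    "(\<lambda>c. snd (snd c)) \<in> measurable (coin_law CARD('d) h j) (lR j)"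
    unfolding coin_law_eq by measurable
  have sn: "distr (coin_law CARD('d) h j) (lY j \<Otimes>\<^sub>M lR j) snd = lY j \<Otimes>\<^sub>M lR j"
    unfolding coin_law_eq by (rule distr_pair_snd[OF lX_prob yr])
  have dX: "distr (coin_law CARD('d) h j) (lX j) fst = lX j"
    unfolding coin_law_eq by (rule prob_space.distr_pair_fst[OF yr])
  have "distr (coin_law CARD('d) h j) (lY j) (\<lambda>c. fst (snd c)) =
      distr (distr (coin_law CARD('d) h j) (lY j \<Otimes>\<^sub>M lR j) snd) (lY j) fst"
    by (subst distr_distr) (simp_all add: coin_law_eq comp_def)
  also have "\<dots> = lY j" unfolding sn by (rule prob_space.distr_pair_fst[OF lR_prob])
  finally have dY: "distr (coin_law CARD('d) h j) (lY j) (\<lambda>c. fst (snd c)) = lY j" .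
  have "distr (coin_law CARD('d) h j) (lR j) (\<lambda>c. snd (snd c)) =
      distr (distr (coin_law CARD('d) h j) (lY j \<Otimes>\<^sub>M lR j) snd) (lR j) snd"
    by (subst distr_distr) (simp_all add: coin_law_eq comp_def)
  also have "\<dots> = lR j" unfolding sn by (rule distr_pair_snd[OF lY_prob lR_prob])
  finally have dR: "distr (coin_law CARD('d) h j) (lR j) (\<lambda>c. snd (snd c)) = lR j" .
  show "(\<lambda>w. X i w j) \<in> measurable P (lX j)" "distr P (lX j) (\<lambda>w. X i w j) = lX j"
    unfolding X_def using coin_distr_compose[OF i m(1)] by (simp_all only: dX)
  show "(\<lambda>w. Y i w j) \<in> measurable P (lY j)" "distr P (lY j) (\<lambda>w. Y i w j) = lY j"
    unfolding Y_def using coin_distr_compose[OF i m(2)] by (simp_all only: dY)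
  show "(\<lambda>w. R i w j) \<in> measurable P (lR j)" "distr P (lR j) (\<lambda>w. R i w j) = lR j"
    unfolding R_def using coin_distr_compose[OF i m(3)] by (simp_all only: dR)
qed

text \<open>A box constrains the walks and the coins of the first \<open>m\<close> shells of all
  explorers. Its probability factorises along the nested products: over explorers, between walk and
  coins, over shells, and within a triple of coins.\<close>

lemma measure_box:
  assumes W: "\<And>i. BW i \<in> sets srw_law" and XY: "\<And>i j. BX i j \<in> sets (lX j)" "\<And>i j. BY i j \<in> sets (lY j)"
    and R: "\<And>i j. BR i j \<in> sets (lR j)"
  shows "measure P {w \<in> space P. \<forall>i\<in>{1..N}. S i w \<in> BW i \<and>
      (\<forall>j<m. X i w j \<in> BX i j \<and> Y i w j \<in> BY i j \<and> R i w j \<in> BR i j)} =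
    (\<Prod>i\<in>{1..N}. measure srw_law (BW i) *
      (\<Prod>j<m. measure (lX j) (BX i j) * (measure (lY j) (BY i j) * measure (lR j) (BR i j))))"
proof -
  interpret coins: product_prob_space "coin_law CARD('d) h" UNIV
    by (intro product_prob_spaceI coin_law_prob)
  interpret prod: product_prob_space "\<lambda>_. E" "{1..N}"
    by (intro product_prob_spaceI E_prob)
  define cyl where "cyl i = prod_emb UNIV (coin_law CARD('d) h) {..<m}
      (Pi\<^sub>E {..<m} (\<lambda>j. BX i j \<times> (BY i j \<times> BR i j)))" for i :: nat
  have sets: "BX i j \<times> (BY i j \<times> BR i j) \<in> sets (coin_law CARD('d) h j)" for i j
    unfolding coin_law_eq by (intro pair_measureI XY R)
  have cyl_sets: "cyl i \<in> sets (\<Pi>\<^sub>M j\<in>UNIV. coin_law CARD('d) h j)" for i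
    unfolding cyl_def by (rule sets_PiM_I) (use sets in auto)
  have space: "space (coin_law CARD('d) h j) = UNIV" for j
    by (simp add: coin_law_def space_pair_measure)
  have cyl: "measure (\<Pi>\<^sub>M j\<in>UNIV. coin_law CARD('d) h j) (cyl i) =
      (\<Prod>j<m. measure (lX j) (BX i j) * (measure (lY j) (BY i j) * measure (lR j) (BR i j)))" for i
  proof -
    have "measure (coin_law CARD('d) h j) (BX i j \<times> (BY i j \<times> BR i j)) =
        measure (lX j) (BX i j) * (measure (lY j) (BY i j) * measure (lR j) (BR i j))" for j
      unfolding coin_law_eq
      by (simp only: measure_pair_Times[OF prob_space_pair[OF lY_prob lR_prob] XY(1) pair_measureI[OF XY(2) R]]
          measure_pair_Times[OF lR_prob XY(2) R])
    then show ?thesis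
      unfolding cyl_def by (subst coins.measure_PiM_emb) (use sets in auto)
  qed
  have "{w \<in> space P. \<forall>i\<in>{1..N}. S i w \<in> BW i \<and>
      (\<forall>j<m. X i w j \<in> BX i j \<and> Y i w j \<in> BY i j \<and> R i w j \<in> BR i j)} =
      prod_emb {1..N} (\<lambda>_. E) {1..N} (Pi\<^sub>E {1..N} (\<lambda>i. BW i \<times> cyl i))"
  proof -
    have cyl_iff: "c \<in> cyl i \<longleftrightarrow> (\<forall>j<m. fst (c j) \<in> BX i j \<and> fst (snd (c j)) \<in> BY i j \<and> snd (snd (c j)) \<in> BR i j)" for c i
      unfolding cyl_def prod_emb_def by (auto simp: space space_PiM PiE_iff mem_Times_iff)
    have "w i \<in> BW i \<times> cyl i \<longleftrightarrow> S i w \<in> BW i \<and>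
        (\<forall>j<m. X i w j \<in> BX i j \<and> Y i w j \<in> BY i j \<and> R i w j \<in> BR i j)" for w i
      by (simp add: mem_Times_iff cyl_iff S_def X_def Y_def R_def)
    note eq = this[symmetric]
    show ?thesis unfolding eq
      by (auto simp: P_eq prod_emb_def space_PiM PiE_iff extensional_def)
  qed
  moreover have "measure (\<Pi>\<^sub>M i\<in>{1..N}. E) (prod_emb {1..N} (\<lambda>_. E) {1..N} (Pi\<^sub>E {1..N} (\<lambda>i. BW i \<times> cyl i))) =
      (\<Prod>i\<in>{1..N}. measure E (BW i \<times> cyl i))"
    by (rule prod.measure_PiM_emb[OF order_refl])
      (simp, unfold E_eq, rule pair_measureI[OF W cyl_sets])
  moreover have "measure E (BW i \<times> cyl i) = measure srw_law (BW i) *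
      measure (\<Pi>\<^sub>M j\<in>UNIV. coin_law CARD('d) h j) (cyl i)" for i
    unfolding E_eq by (rule measure_pair_Times[OF coins_prob W cyl_sets])
  ultimately show ?thesis unfolding cyl by (simp only: P_eq)
qed

text \<open>Independence is tested on finite families of sources of mixed kinds. Such a family is
  padded with the whole space to a full box, where \<open>measure_box\<close> applies; the padding
  contributes factors 1.\<close>

lemma sources_indep: "prob_space.indep_sets P (source_algebra P S X Y R) {s. explorer s \<in> {1..N}}"
proof -
  interpret P: prob_space P by (rule P_prob)
  let ?\<A> = "source_algebra P S X Y R"
  show ?thesis
  proof (rule P.indep_setsI)
    fix s assume "s \<in> {s. explorer s \<in> {1..N}}"
    then have i: "explorer s \<in> {1..N}" by simp
    show "?\<A> s \<subseteq> P.events"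
    proof (cases s)
      case (Walk i)
      have "S i \<in> measurable P trajectory_space"
        using S_meas_P[of i] i Walk unfolding measurable_cong_sets[OF refl sets_srw_law] by simp
      then have "generated P (S i) trajectory_space \<subseteq> P.events" by (rule generated_subset)
      then show ?thesis by (simp add: source_algebra_def Walk)
    next
      case (Coin_X i j)
      have "(\<lambda>w. X i w j) \<in> measurable P (count_space UNIV)"
        using X_meas[of i j] i Coin_X by (simp add: lX_def)
      then have "generated P (\<lambda>w. X i w j) (count_space UNIV) \<subseteq> P.events" by (rule generated_subset)
      then show ?thesis by (simp add: source_algebra_def Coin_X)
    next
      case (Coin_Y i j)
      have "(\<lambda>w. Y i w j) \<in> measurable P (count_space UNIV)"
        using Y_meas[of i j] i Coin_Y by (simp add: lY_def)
      then have "generated P (\<lambda>w. Y i w j) (count_space UNIV) \<subseteq> P.events" by (rule generated_subset)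
      then show ?thesis by (simp add: source_algebra_def Coin_Y)
    next
      case (Radius_R i j)
      have "(\<lambda>w. R i w j) \<in> measurable P borel"
        using R_meas[of i j] i Radius_R by (simp add: lR_def)
      then have "generated P (\<lambda>w. R i w j) borel \<subseteq> P.events" by (rule generated_subset)
      then show ?thesis by (simp add: source_algebra_def Radius_R)
    qed
  next
    fix A J assume J: "J \<noteq> {}" "J \<subseteq> {s. explorer s \<in> {1..N}}" "finite J" "\<forall>j\<in>J. A j \<in> ?\<A> j"
    define A' where "A' s = (if s \<in> J then A s else space P)" for s
    have A': "A' s \<in> ?\<A> s" for s
    proof (cases "s \<in> J")
      case False
      have "space P \<in> ?\<A> s"
        by (cases s) (simp_all add: source_algebra_def space_in_generated)
      then show ?thesis using False by (simp add: A'_def)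
    qed (use J in \<open>simp add: A'_def\<close>)
    have "\<exists>B\<in>sets srw_law. A' (Walk i) = S i -` B \<inter> space P" for i
      using A'[of "Walk i"] by (intro generatedE) (auto simp: source_algebra_def)
    then obtain BW where BW: "BW i \<in> sets srw_law" "A' (Walk i) = S i -` BW i \<inter> space P" for i
      by metis
    have "\<exists>B\<in>sets (lX j). A' (Coin_X i j) = (\<lambda>w. X i w j) -` B \<inter> space P" for i j
      using A'[of "Coin_X i j"] by (intro generatedE) (auto simp: source_algebra_def lX_def)
    from choice2[where Q = "\<lambda>j. sets (lX j)", OF this]
    obtain BX where "\<forall>i j. BX i j \<in> sets (lX j) \<and> A' (Coin_X i j) = (\<lambda>w. X i w j) -` BX i j \<inter> space P" ..
    then have BX: "BX i j \<in> sets (lX j)" "A' (Coin_X i j) = (\<lambda>w. X i w j) -` BX i j \<inter> space P" for i j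
      by blast+
    have "\<exists>B\<in>sets (lY j). A' (Coin_Y i j) = (\<lambda>w. Y i w j) -` B \<inter> space P" for i j
      using A'[of "Coin_Y i j"] by (intro generatedE) (auto simp: source_algebra_def lY_def)
    from choice2[where Q = "\<lambda>j. sets (lY j)", OF this]
    obtain BY where "\<forall>i j. BY i j \<in> sets (lY j) \<and> A' (Coin_Y i j) = (\<lambda>w. Y i w j) -` BY i j \<inter> space P" ..
    then have BY: "BY i j \<in> sets (lY j)" "A' (Coin_Y i j) = (\<lambda>w. Y i w j) -` BY i j \<inter> space P" for i j
      by blast+
    have "\<exists>B\<in>sets (lR j). A' (Radius_R i j) = (\<lambda>w. R i w j) -` B \<inter> space P" for i j
      using A'[of "Radius_R i j"] by (intro generatedE) (auto simp: source_algebra_def lR_def)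
    from choice2[where Q = "\<lambda>j. sets (lR j)", OF this]
    obtain BR where "\<forall>i j. BR i j \<in> sets (lR j) \<and> A' (Radius_R i j) = (\<lambda>w. R i w j) -` BR i j \<inter> space P" ..
    then have BR: "BR i j \<in> sets (lR j)" "A' (Radius_R i j) = (\<lambda>w. R i w j) -` BR i j \<inter> space P" for i j
      by blast+
    \<comment> \<open>The shell to which a source belongs; a walk belongs to none and gets the
      harmless value 0. The bound \<open>m\<close> is the number of shells that the box has to
      include.\<close>
    define idx where "idx s = (case s of Walk _ \<Rightarrow> 0 | Coin_X _ j \<Rightarrow> j | Coin_Y _ j \<Rightarrow> j | Radius_R _ j \<Rightarrow> j)" for s
    obtain m where m: "idx s < m" if "s \<in> J" for s
      using finite_nat_set_iff_bounded[of "idx ` J"] J(3) by auto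
    define F where "F i j = {Coin_X i j, Coin_Y i j, Radius_R i j}" for i j
    define Full where "Full i = insert (Walk i) (\<Union>j<m. F i j)" for i
    have "s \<in> Full (explorer s)" if "s \<in> J" for s
      using m[OF that] by (cases s) (auto simp: Full_def F_def idx_def)
    then have J_sub: "J \<subseteq> (\<Union>i\<in>{1..N}. Full i)" using J(2) by blast
    have "(\<Inter>s\<in>J. A s) = (\<Inter>s\<in>(\<Union>i\<in>{1..N}. Full i). A' s)"
      if "(\<Inter>s\<in>J. A s) \<subseteq> space P"
    proof (intro equalityI INT_greatest)
      show "(\<Inter>s\<in>J. A s) \<subseteq> A' s" for s using that unfolding A'_def by (cases "s \<in> J") auto
      show "(\<Inter>s\<in>(\<Union>i\<in>{1..N}. Full i). A' s) \<subseteq> A s" if "s \<in> J" for s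
      proof -
        have "A' s = A s" using that by (simp add: A'_def)
        then show ?thesis using INT_lower[of s "\<Union>i\<in>{1..N}. Full i" A'] J_sub that by blast
      qed
    qed
    moreover have "(\<Inter>s\<in>J. A s) \<subseteq> space P"
    proof -
      obtain s where s: "s \<in> J" using J(1) by blast
      have "A' s \<subseteq> space P" using BW BX BY BR by (cases s) auto
      then show ?thesis using s by (auto simp: A'_def)
    qed
    moreover have "(\<Inter>s\<in>(\<Union>i\<in>{1..N}. Full i). A' s) = {w \<in> space P. \<forall>i\<in>{1..N}. S i w \<in> BW i \<and>
      (\<forall>j<m. X i w j \<in> BX i j \<and> Y i w j \<in> BY i j \<and> R i w j \<in> BR i j)}"
    proof -
      \<comment> \<open>There is at least one explorer, so the intersection over the box is not an
        empty one and is contained in the space.\<close>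
      obtain s where s: "s \<in> (\<Union>i\<in>{1..N}. Full i)" using J(1) J_sub by blast
      then have "1 \<le> N" by auto
      then have one: "1 \<in> {1..N}" by simp
      have iff: "(\<forall>s\<in>Full i. w \<in> A' s) \<longleftrightarrow> w \<in> space P \<and> S i w \<in> BW i \<and>
          (\<forall>j<m. X i w j \<in> BX i j \<and> Y i w j \<in> BY i j \<and> R i w j \<in> BR i j)" for i w
      proof -
        have "(\<forall>s\<in>Full i. w \<in> A' s) \<longleftrightarrow> w \<in> A' (Walk i) \<and> (\<forall>j<m. w \<in> A' (Coin_X i j) \<and>
            w \<in> A' (Coin_Y i j) \<and> w \<in> A' (Radius_R i j))"
          unfolding Full_def F_def by blast
        then show ?thesis unfolding BW(2) BX(2) BY(2) BR(2) by blast
      qed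
      have "w \<in> (\<Inter>s\<in>(\<Union>i\<in>{1..N}. Full i). A' s) \<longleftrightarrow> (\<forall>i\<in>{1..N}. \<forall>s\<in>Full i. w \<in> A' s)" for w
        by blast
      then show ?thesis unfolding iff using one by blast
    qed
    ultimately have "P.prob (\<Inter>s\<in>J. A s) = (\<Prod>i\<in>{1..N}. measure srw_law (BW i) *
      (\<Prod>j<m. measure (lX j) (BX i j) * (measure (lY j) (BY i j) * measure (lR j) (BR i j))))"
      using measure_box[OF BW(1) BX(1) BY(1) BR(1), where m = m] by simp
    also have "\<dots> = (\<Prod>i\<in>{1..N}. P.prob (A' (Walk i)) *
      (\<Prod>j<m. P.prob (A' (Coin_X i j)) * (P.prob (A' (Coin_Y i j)) * P.prob (A' (Radius_R i j)))))"
    proof (rule prod.cong[OF refl])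
      fix i assume i: "i \<in> {1..N}"
      have "P.prob (A' (Walk i)) = measure srw_law (BW i)"
        using measure_distr[OF S_meas_P[OF i] BW(1)[of i]] by (simp add: S_distr[OF i] BW(2))
      moreover have "P.prob (A' (Coin_X i j)) = measure (lX j) (BX i j)" for j
        using measure_distr[OF X_meas[OF i] BX(1)[of i j]] by (simp add: X_distr[OF i] BX(2))
      moreover have "P.prob (A' (Coin_Y i j)) = measure (lY j) (BY i j)" for j
        using measure_distr[OF Y_meas[OF i] BY(1)[of i j]] by (simp add: Y_distr[OF i] BY(2))
      moreover have "P.prob (A' (Radius_R i j)) = measure (lR j) (BR i j)" for j
        using measure_distr[OF R_meas[OF i] BR(1)[of i j]] by (simp add: R_distr[OF i] BR(2))
      ultimately show "measure srw_law (BW i) *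
          (\<Prod>j<m. measure (lX j) (BX i j) * (measure (lY j) (BY i j) * measure (lR j) (BR i j))) =
          P.prob (A' (Walk i)) *
          (\<Prod>j<m. P.prob (A' (Coin_X i j)) * (P.prob (A' (Coin_Y i j)) * P.prob (A' (Radius_R i j))))"
        by (simp only:)
    qed
    also have "\<dots> = (\<Prod>i\<in>{1..N}. \<Prod>s\<in>Full i. P.prob (A' s))"
    proof (rule prod.cong[OF refl])
      fix i :: nat
      have "(\<Prod>s\<in>(\<Union>j<m. F i j). P.prob (A' s)) = (\<Prod>j<m. \<Prod>s\<in>F i j. P.prob (A' s))"
        by (rule prod.UNION_disjoint) (auto simp: F_def)
      then show "P.prob (A' (Walk i)) *
          (\<Prod>j<m. P.prob (A' (Coin_X i j)) * (P.prob (A' (Coin_Y i j)) * P.prob (A' (Radius_R i j)))) =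
          (\<Prod>s\<in>Full i. P.prob (A' s))"
        by (simp add: Full_def F_def)
    qed
    also have "\<dots> = (\<Prod>s\<in>(\<Union>i\<in>{1..N}. Full i). P.prob (A' s))"
      by (rule prod.UNION_disjoint[symmetric]) (auto simp: Full_def F_def)
    also have "\<dots> = (\<Prod>s\<in>J. P.prob (A' s))"
      by (rule prod.mono_neutral_right[OF _ J_sub])
        (auto simp: Full_def F_def A'_def P.prob_space)
    also have "\<dots> = (\<Prod>s\<in>J. P.prob (A s))" by (rule prod.cong) (auto simp: A'_def)
    finally show "P.prob (\<Inter>s\<in>J. A s) = (\<Prod>s\<in>J. P.prob (A s))" .
  qed
qed

lemma flashing_explorers_exist: "flashing_explorers P h N S X Y R"
  unfolding flashing_explorers_def
proof (intro conjI ballI allI)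
  show "prob_space P" by (rule P_prob)
  show "prob_space.indep_sets P (source_algebra P S X Y R) {s. explorer s \<in> {1..N}}"
    by (rule sources_indep)
  fix i assume i: "i \<in> {1..N}"
  show "S i \<in> measurable P trajectory_space"
    using S_meas_P[OF i] unfolding measurable_cong_sets[OF refl sets_srw_law] .
  show "distr P trajectory_space (S i) = srw_law"
    using S_distr[OF i] distr_cong[OF refl sets_srw_law, of P "S i" "S i"] by simp
  fix j
  show "(\<lambda>w. X i w j) \<in> measurable P (count_space UNIV)" using X_meas[OF i, of j] by (simp add: lX_def)
  show "(\<lambda>w. Y i w j) \<in> measurable P (count_space UNIV)" using Y_meas[OF i, of j] by (simp add: lY_def)
  have "measure P ((\<lambda>w. X i w j) -` {True} \<inter> space P) = measure (lX j) {True}"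
    using measure_distr[OF X_meas[OF i, of j], of "{True}", unfolded X_distr[OF i]] by (simp add: lX_def)
  moreover have "0 \<le> 1 / real (h j) ^ CARD('d)" "1 / real (h j) ^ CARD('d) \<le> 1"
    using h[of j] by (simp_all add: Suc_leI)
  ultimately show "measure P {w \<in> space P. X i w j} = 1 / real (h j) ^ CARD('d)"
    by (simp add: lX_def measure_pmf_single vimage_def Int_def conj_commute)
  have "measure P ((\<lambda>w. Y i w j) -` {True} \<inter> space P) = measure (lY j) {True}"
    using measure_distr[OF Y_meas[OF i, of j], of "{True}", unfolded Y_distr[OF i]] by (simp add: lY_def)
  then show "measure P {w \<in> space P. Y i w j} = (if j = 0 then 1 else 1 / 2)"
    by (simp add: lY_def measure_pmf_single vimage_def Int_def conj_commute)
  have "(\<lambda>w. R i w j) \<in> measurable P lborel" using R_meas[OF i, of j] by (simp add: lR_def)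
  moreover have "distr P lborel (\<lambda>w. R i w j) = density lborel (radius_density CARD('d) (h j))"
    using R_distr[OF i, of j] distr_cong[of P P lborel "lR j" "\<lambda>w. R i w j" "\<lambda>w. R i w j"]
    by (simp add: lR_def)
  ultimately show "distributed P lborel (\<lambda>w. R i w j)
      (\<lambda>r. ennreal (real CARD('d) * r ^ (CARD('d) - 1) / real (h j) ^ CARD('d) * indicator {0..real (h j)} r))"
    unfolding distributed_def radius_density_def[symmetric] by simp
qed

end

text \<open>The space is the explicit product \<open>explorers_law h N\<close>. The relations inside
  the almost sure statement can fail only if some walk is not \<open>escaping\<close> or some
  explorer has finitely many favourable shells; there a settling time may be infinite, and
  \<open>the_enat\<close> then carries no information.\<close>

theorem lemma1p3:
  fixes h :: "nat \<Rightarrow> nat" and N :: nat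
  assumes "CARD('d::finite) \<ge> 2"
    and "N > 0"
    and "\<And>j. h j > 0"
  shows "\<exists>(M :: (nat \<Rightarrow> (nat \<Rightarrow> int ^ 'd) \<times> (nat \<Rightarrow> bool \<times> bool \<times> real)) measure)
            (S :: nat \<Rightarrow> _ \<Rightarrow> nat \<Rightarrow> int ^ 'd) X Y R
            (T :: nat \<Rightarrow> _ \<Rightarrow> nat) (T' :: nat \<Rightarrow> _ \<Rightarrow> nat) A A'.
     flashing_explorers M h N S X Y R \<and>
     (\<forall>i\<in>{1..N}. T i \<in> measurable M (count_space UNIV) \<and> T' i \<in> measurable M (count_space UNIV)) \<and>
     A \<in> measurable M (count_space UNIV) \<and> distr M (count_space UNIV) A = idla_law N \<and>
     (\<forall>w\<in>space M. A' w =
        flashing_cluster h (\<lambda>i. S i w) (\<lambda>i. X i w) (\<lambda>i. Y i w) (\<lambda>i. R i w) N) \<and>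
     (AE w in M.
        (\<forall>i\<in>{1..N}. enat (T' i w) =
           settling_time h (S i w) (X i w) (Y i w) (R i w)
             (flashing_cluster h (\<lambda>i. S i w) (\<lambda>i. X i w) (\<lambda>i. Y i w) (\<lambda>i. R i w) (i - 1))) \<and>
        A w = (\<Union>i\<in>{1..N}. {S i w (T i w)}) \<and>
        A' w = (\<Union>i\<in>{1..N}. {S i w (T' i w)}) \<and>
        (\<forall>i\<in>{1..N}. T' i w \<ge> T i w))"
proof -
  define M :: "(nat \<Rightarrow> (nat \<Rightarrow> int ^ 'd) \<times> (nat \<Rightarrow> bool \<times> bool \<times> real)) measure"
    where "M = explorers_law h N"
  define S :: "nat \<Rightarrow> (nat \<Rightarrow> (nat \<Rightarrow> int ^ 'd) \<times> (nat \<Rightarrow> bool \<times> bool \<times> real)) \<Rightarrow> nat \<Rightarrow> int ^ 'd"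
    where "S = (\<lambda>i w. fst (w i))"
  define X :: "nat \<Rightarrow> (nat \<Rightarrow> (nat \<Rightarrow> int ^ 'd) \<times> (nat \<Rightarrow> bool \<times> bool \<times> real)) \<Rightarrow> nat \<Rightarrow> bool"
    where "X = (\<lambda>i w j. fst (snd (w i) j))"
  define Y :: "nat \<Rightarrow> (nat \<Rightarrow> (nat \<Rightarrow> int ^ 'd) \<times> (nat \<Rightarrow> bool \<times> bool \<times> real)) \<Rightarrow> nat \<Rightarrow> bool"
    where "Y = (\<lambda>i w j. fst (snd (snd (w i) j)))"
  define R :: "nat \<Rightarrow> (nat \<Rightarrow> (nat \<Rightarrow> int ^ 'd) \<times> (nat \<Rightarrow> bool \<times> bool \<times> real)) \<Rightarrow> nat \<Rightarrow> real"
    where "R = (\<lambda>i w j. snd (snd (snd (w i) j)))"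
  have explorers: "flashing_explorers M h N S X Y R"
    unfolding M_def S_def X_def Y_def R_def by (rule flashing_explorers_exist[OF assms(3)])
  interpret flashing_process M h N S X Y R
    by unfold_locales (use explorers assms in auto)
  let ?T' = "\<lambda>i w. the_enat (settling i w)"
  have T'_meas: "?T' i \<in> measurable M (count_space UNIV)" if "i \<in> {1..N}" for i
    by (rule measurable_compose[OF settling_meas[OF that]]) simp
  have pointwise: "AE w in M.
      (\<forall>i\<in>{1..N}. enat (?T' i w) = settling_time h (S i w) (X i w) (Y i w) (R i w) (cluster w (i - 1))) \<and>
      occupied (final_history w) = (\<Union>i\<in>{1..N}. {S i w (stop_time i w)}) \<and>
      cluster w N = (\<Union>i\<in>{1..N}. {S i w (?T' i w)}) \<and> (\<forall>i\<in>{1..N}. ?T' i w \<ge> stop_time i w)"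
    using AE_coupling
  proof eventually_elim
    case (elim w)
    then show ?case
      using coupling_pointwise[of w] unfolding settling_def by blast
  qed
  show ?thesis
    by (rule exI[of _ M], rule exI[of _ S], rule exI[of _ X], rule exI[of _ Y], rule exI[of _ R],
        rule exI[of _ stop_time], rule exI[of _ ?T'],
        rule exI[of _ "\<lambda>w. occupied (final_history w)"], rule exI[of _ "\<lambda>w. cluster w N"],
        intro conjI ballI)
      (rule explorers stop_time_meas T'_meas occupied_final_history_meas distr_final_cluster pointwise refl;
        assumption)+
qed

end
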